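(* Let $(\mathfrak{g},[~,~]_\mathfrak{g},\alpha)$ and $(\mathfrak{h},[~,~]_\mathfrak{h},\beta)$ be two (multiplicative) Hom-Lie algebras. Then the direct sum graded vector space $C^{\bullet+1}_{\mathrm{Hom}}(\mathfrak{g},\mathfrak{g})\oplus C^\bullet_{\mathrm{Hom}}(\mathfrak{g},\mathfrak{h})$ carries a graded Lie algebra structure with bracket given by $$[(P,E),(Q,F)]_\ltimes:=\big([P,Q]_{\mathsf{NR}},\ [E,F]_{\mathsf{C}}+i_PF-(-1)^{mn}i_QE\big),$$ for homogeneous elements $(P,E)\in C^{m+1}_{\mathrm{Hom}}(\mathfrak{g},\mathfrak{g})\oplus C^m_{\mathrm{Hom}}(\mathfrak{g},\mathfrak{h})$ and $(Q,F)\in C^{n+1}_{\mathrm{Hom}}(\mathfrak{g},\mathfrak{g})\oplus C^n_{\mathrm{Hom}}(\mathfrak{g},\mathfrak{h})$. Moreover, $(C^{\bullet+1}_{\mathrm{Hom}}(\mathfrak{g},\mathfrak{g}),[~,~]_{\mathsf{NR}})$ is a graded Lie subalgebra and $C^\bullet_{\mathrm{Hom}}(\mathfrak{g},\mathfrak{h})$ is an ideal of the graded Lie algebra $(C^{\bullet+1}_{\mathrm{Hom}}(\mathfrak{g},\mathfrak{g})\oplus C^\bullet_{\mathrm{Hom}}(\mathfrak{g},\mathfrak{h}),[~,~]_\ltimes)$.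
   Context: All vector spaces and (multi)linear maps are over a field $\mathbf{k}$ of characteristic $0$. A (multiplicative) Hom-Lie algebra $(\mathfrak{g},[~,~],\alpha)$ is a vector space $\mathfrak{g}$ with a skew-symmetric bilinear map $[~,~]$ and a linear map $\alpha:\mathfrak{g}\to\mathfrak{g}$ such that $[\alpha(x),[y,z]]+[\alpha(y),[z,x]]+[\alpha(z),[x,y]]=0$ and $\alpha([x,y])=[\alpha(x),\alpha(y)]$. For $n\ge 1$, $C^n_{\mathrm{Hom}}(\mathfrak{g},\mathfrak{h})=\{f:\wedge^n\mathfrak{g}\to\mathfrak{h}\mid \beta\circ f=f\circ\alpha^{\wedge n}\}$, and similarly $C^n_{\mathrm{Hom}}(\mathfrak{g},\mathfrak{g})$ (with $\beta$ replaced by $\alpha$). $Sh(m,n)$ is the set of $(m,n)$-shuffles. For $P\in C^m_{\mathrm{Hom}}(\mathfrak{g},\mathfrak{g})$ and $Q\in C^n_{\mathrm{Hom}}(\mathfrak{g},V)$ with $V=\mathfrak{g}$ or $\mathfrak{h}$, the contraction $i_PQ\in C^{m+n-1}_{\mathrm{Hom}}(\mathfrak{g},V)$ is $$(i_PQ)(x_1,\ldots,x_{m+n-1})=\sum_{\sigma\in Sh(m,n-1)}(-1)^\sigma Q\big(P(x_{\sigma(1)},\ldots,x_{\sigma(m)}),\alpha^{m-1}x_{\sigma(m+1)},\ldots,\alpha^{m-1}x_{\sigma(m+n-1)}\big).$$ The Nijenhuis-Richardson bracket of $P\in C^m_{\mathrm{Hom}}(\mathfrak{g},\mathfrak{g})$,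 $Q\in C^n_{\mathrm{Hom}}(\mathfrak{g},\mathfrak{g})$ is $[P,Q]_{\mathsf{NR}}=i_PQ-(-1)^{(m-1)(n-1)}i_QP$. The cup product bracket of $P\in C^m_{\mathrm{Hom}}(\mathfrak{g},\mathfrak{h})$, $Q\in C^n_{\mathrm{Hom}}(\mathfrak{g},\mathfrak{h})$ is $$[P,Q]_{\mathsf{C}}(x_1,\ldots,x_{m+n})=\sum_{\sigma\in Sh(m,n)}(-1)^\sigma[\beta^{n-1}P(x_{\sigma(1)},\ldots,x_{\sigma(m)}),\beta^{m-1}Q(x_{\sigma(m+1)},\ldots,x_{\sigma(m+n)})]_\mathfrak{h}.$$ In $C^{\bullet+1}_{\mathrm{Hom}}(\mathfrak{g},\mathfrak{g})=\bigoplus_{m\ge0}C^{m+1}_{\mathrm{Hom}}(\mathfrak{g},\mathfrak{g})$ the summand $C^{m+1}_{\mathrm{Hom}}$ has degree $m$; in $C^\bullet_{\mathrm{Hom}}(\mathfrak{g},\mathfrak{h})=\bigoplus_{m\ge1}C^m_{\mathrm{Hom}}(\mathfrak{g},\mathfrak{h})$ the summand $C^m_{\mathrm{Hom}}$ has degree $m$ (so the degree-$0$ part is $0$). Graded Lie algebras have degree $0$ brackets satisfying graded skew-symmetry and the graded Jacobi identity. *)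

theory Defs
  imports
    "HOL-Analysis.Product_Vector"
    "HOL-Combinatorics.Permutations"
    "HOL-Library.Function_Algebras"
begin

section \<open>Hom-Lie algebras\<close>

text \<open>Multiplicative Hom-Lie algebras; the underlying vector space is the whole type \<open>'g\<close>.\<close>

locale hom_lie_algebra = vector_space scale
  for scale :: "'k::field_char_0 \<Rightarrow> 'g::ab_group_add \<Rightarrow> 'g" +
  fixes bracket :: "'g \<Rightarrow> 'g \<Rightarrow> 'g"
    and \<alpha> :: "'g \<Rightarrow> 'g"
  assumes linear_right: "Vector_Spaces.linear scale scale (\<lambda>y. bracket x y)"
    and linear_left: "Vector_Spaces.linear scale scale (\<lambda>x. bracket x y)"
    and skew: "bracket x y = - bracket y x"
    and linear_twist: "Vector_Spaces.linear scale scale \<alpha>"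
    and hom_jacobi:
      "bracket (\<alpha> x) (bracket y z) + bracket (\<alpha> y) (bracket z x) + bracket (\<alpha> z) (bracket x y) = 0"
    and multiplicative: "\<alpha> (bracket x y) = bracket (\<alpha> x) (\<alpha> y)"

section \<open>Graded Lie algebras\<close>

definition total_space :: "('k::field \<Rightarrow> 'v::ab_group_add \<Rightarrow> 'v) \<Rightarrow> (nat \<Rightarrow> 'v set) \<Rightarrow> 'v set"
  where "total_space s V = module.span s (\<Union>n. V n)"

text \<open>
  The underlying graded vector space is the internal direct sum of the subspaces \<open>V n\<close> of the
  ambient vector space \<open>'v\<close>; all other degrees are zero. The bracket is only constrained on
  this direct sum, not on the rest of \<open>'v\<close>.
\<close>

locale graded_lie_algebra = vector_space scale
  for scale :: "'k::field_char_0 \<Rightarrow> 'v::ab_group_add \<Rightarrow> 'v" +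
  fixes V :: "nat \<Rightarrow> 'v set"
    and bracket :: "'v \<Rightarrow> 'v \<Rightarrow> 'v"
  assumes subspace_V: "subspace (V n)"
    and direct:
      "\<lbrakk>finite I; \<And>n. n \<in> I \<Longrightarrow> u n \<in> V n; (\<Sum>n\<in>I. u n) = 0; n \<in> I\<rbrakk> \<Longrightarrow> u n = 0"
    and add_left:
      "\<lbrakk>x \<in> total_space scale V; x' \<in> total_space scale V; y \<in> total_space scale V\<rbrakk>
        \<Longrightarrow> bracket (x + x') y = bracket x y + bracket x' y"
    and add_right:
      "\<lbrakk>x \<in> total_space scale V; y \<in> total_space scale V; y' \<in> total_space scale V\<rbrakk>
        \<Longrightarrow> bracket x (y + y') = bracket x y + bracket x y'"
    and scale_left:
      "\<lbrakk>x \<in> total_space scale V; y \<in> total_space scale V\<rbrakk>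
        \<Longrightarrow> bracket (scale c x) y = scale c (bracket x y)"
    and scale_right:
      "\<lbrakk>x \<in> total_space scale V; y \<in> total_space scale V\<rbrakk>
        \<Longrightarrow> bracket x (scale c y) = scale c (bracket x y)"
    and degree_zero: "\<lbrakk>x \<in> V m; y \<in> V n\<rbrakk> \<Longrightarrow> bracket x y \<in> V (m + n)"
    and graded_skew: "\<lbrakk>x \<in> V m; y \<in> V n\<rbrakk> \<Longrightarrow> bracket x y = - scale ((-1) ^ (m * n)) (bracket y x)"
    and graded_jacobi:
      "\<lbrakk>x \<in> V m; y \<in> V n; z \<in> V p\<rbrakk> \<Longrightarrow>
        bracket x (bracket y z)
          = bracket (bracket x y) z + scale ((-1) ^ (m * n)) (bracket y (bracket x z))"

locale graded_lie_subalgebra = graded_lie_algebra scale V bracket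
  for scale :: "'k::field_char_0 \<Rightarrow> 'v::ab_group_add \<Rightarrow> 'v" and V bracket +
  fixes W :: "nat \<Rightarrow> 'v set"
  assumes subspace_W: "subspace (W n)"
    and W_subset: "W n \<subseteq> V n"
    and W_closed: "\<lbrakk>x \<in> W m; y \<in> W n\<rbrakk> \<Longrightarrow> bracket x y \<in> W (m + n)"

locale graded_lie_ideal = graded_lie_algebra scale V bracket
  for scale :: "'k::field_char_0 \<Rightarrow> 'v::ab_group_add \<Rightarrow> 'v" and V bracket +
  fixes W :: "nat \<Rightarrow> 'v set"
  assumes subspace_W: "subspace (W n)"
    and W_subset: "W n \<subseteq> V n"
    and W_absorbs_left: "\<lbrakk>x \<in> V m; y \<in> W n\<rbrakk> \<Longrightarrow> bracket x y \<in> W (m + n)"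
    and W_absorbs_right: "\<lbrakk>x \<in> W m; y \<in> V n\<rbrakk> \<Longrightarrow> bracket x y \<in> W (m + n)"

text \<open>
  Extends brackets \<open>B m n\<close>, given on homogeneous elements of degrees \<open>m\<close> and \<open>n\<close>, to the direct
  sum, where \<open>\<pi> n\<close> is the projection onto the degree \<open>n\<close> component. Elements of the direct sum
  have finitely many nonzero components, so there both sums are finite.
\<close>

definition bilinear_extension ::
    "(nat \<Rightarrow> 'v \<Rightarrow> 'v) \<Rightarrow> (nat \<Rightarrow> nat \<Rightarrow> 'v \<Rightarrow> 'v \<Rightarrow> 'v) \<Rightarrow> 'v \<Rightarrow> 'v \<Rightarrow> 'v::comm_monoid_add"
  where "bilinear_extension \<pi> B x y =
    (\<Sum>m | \<pi> m x \<noteq> 0. \<Sum>n | \<pi> n y \<noteq> 0. B m n (\<pi> m x) (\<pi> n y))"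

section \<open>Cochains\<close>

text \<open>
  An \<open>n\<close>-linear map is encoded as a function on lists that vanishes on all lists whose length is
  not \<open>n\<close>. Hence maps of different arities are linearly independent inside the function space
  \<open>'g list \<Rightarrow> 'h\<close> (with pointwise operations), and the direct sum of the cochain spaces consists
  of functions on lists.
\<close>

definition fun_scale :: "('k \<Rightarrow> 'h \<Rightarrow> 'h) \<Rightarrow> 'k \<Rightarrow> ('x \<Rightarrow> 'h) \<Rightarrow> 'x \<Rightarrow> 'h"
  where "fun_scale s c f = (\<lambda>x. s c (f x))"

definition alternating_maps ::
    "('k::field \<Rightarrow> 'g::ab_group_add \<Rightarrow> 'g) \<Rightarrow> ('k \<Rightarrow> 'h::ab_group_add \<Rightarrow> 'h) \<Rightarrow> nat \<Rightarrow> ('g list \<Rightarrow> 'h) set"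
  where "alternating_maps sg sh n = {f.
    (\<forall>xs. length xs \<noteq> n \<longrightarrow> f xs = 0) \<and>
    (\<forall>xs i. length xs = n \<and> i < n \<longrightarrow> Vector_Spaces.linear sg sh (\<lambda>x. f (xs[i := x]))) \<and>
    (\<forall>xs i j. length xs = n \<and> i < j \<and> j < n \<and> xs ! i = xs ! j \<longrightarrow> f xs = 0)}"

definition hom_cochains ::
    "('k::field \<Rightarrow> 'g::ab_group_add \<Rightarrow> 'g) \<Rightarrow> ('g \<Rightarrow> 'g) \<Rightarrow>
     ('k \<Rightarrow> 'h::ab_group_add \<Rightarrow> 'h) \<Rightarrow> ('h \<Rightarrow> 'h) \<Rightarrow> nat \<Rightarrow> ('g list \<Rightarrow> 'h) set"
  where "hom_cochains sg \<alpha> sh \<beta> n =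
    {f \<in> alternating_maps sg sh n. \<forall>xs. length xs = n \<longrightarrow> \<beta> (f xs) = f (map \<alpha> xs)}"

text \<open>
  The degree \<open>m\<close> parts of \<open>C\<^bsup>\<bullet>+1\<^esup>(g,g)\<close> and \<open>C\<^bsup>\<bullet>\<^esup>(g,h)\<close>. There are no cochains of arity \<open>0\<close>.
\<close>

definition C_gg ::
    "('k::field \<Rightarrow> 'g::ab_group_add \<Rightarrow> 'g) \<Rightarrow> ('g \<Rightarrow> 'g) \<Rightarrow> nat \<Rightarrow> ('g list \<Rightarrow> 'g) set"
  where "C_gg sg \<alpha> m = hom_cochains sg \<alpha> sg \<alpha> (m + 1)"

definition C_gh ::
    "('k::field \<Rightarrow> 'g::ab_group_add \<Rightarrow> 'g) \<Rightarrow> ('g \<Rightarrow> 'g) \<Rightarrow>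
     ('k \<Rightarrow> 'h::ab_group_add \<Rightarrow> 'h) \<Rightarrow> ('h \<Rightarrow> 'h) \<Rightarrow> nat \<Rightarrow> ('g list \<Rightarrow> 'h) set"
  where "C_gh sg \<alpha> sh \<beta> m = (if m = 0 then {0} else hom_cochains sg \<alpha> sh \<beta> m)"

definition arity_part :: "nat \<Rightarrow> ('g list \<Rightarrow> 'h) \<Rightarrow> 'g list \<Rightarrow> 'h::zero"
  where "arity_part n f = (\<lambda>xs. if length xs = n then f xs else 0)"

section \<open>Contraction and brackets\<close>

text \<open>Shuffles permute \<open>{0..<m+n}\<close>; positions are counted from \<open>0\<close>.\<close>

definition Sh :: "nat \<Rightarrow> nat \<Rightarrow> (nat \<Rightarrow> nat) set"
  where "Sh m n = {\<sigma>. \<sigma> permutes {0..<m+n} \<and>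
    strict_mono_on {0..<m} \<sigma> \<and> strict_mono_on {m..<m+n} \<sigma>}"

text \<open>
  In \<open>contraction\<close>, \<open>nr_bracket\<close> and \<open>cup_bracket\<close>, \<open>m\<close> and \<open>n\<close> are the arities of \<open>P\<close> and \<open>Q\<close>.
  The case \<open>n = 0\<close> of \<open>contraction\<close> and the cases \<open>m = 0\<close>, \<open>n = 0\<close> of \<open>cup_bracket\<close> are only used
  for the zero cochain, where the value is \<open>0\<close> in spite of the truncated subtractions.
\<close>

definition contraction ::
    "('g \<Rightarrow> 'g) \<Rightarrow> ('k::field \<Rightarrow> 'v::ab_group_add \<Rightarrow> 'v) \<Rightarrow> nat \<Rightarrow> nat \<Rightarrow>
     ('g list \<Rightarrow> 'g) \<Rightarrow> ('g list \<Rightarrow> 'v) \<Rightarrow> 'g list \<Rightarrow> 'v"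
  where "contraction \<alpha> sv m n P Q = (\<lambda>xs.
    if length xs = m + n - 1
    then \<Sum>\<sigma>\<in>Sh m (n - 1). sv (of_int (sign \<sigma>))
      (Q (P (map (\<lambda>i. xs ! \<sigma> i) [0..<m]) #
          map (\<lambda>i. (\<alpha> ^^ (m - 1)) (xs ! \<sigma> i)) [m..<m + n - 1]))
    else 0)"

definition nr_bracket ::
    "('g \<Rightarrow> 'g) \<Rightarrow> ('k::field \<Rightarrow> 'g::ab_group_add \<Rightarrow> 'g) \<Rightarrow> nat \<Rightarrow> nat \<Rightarrow>
     ('g list \<Rightarrow> 'g) \<Rightarrow> ('g list \<Rightarrow> 'g) \<Rightarrow> 'g list \<Rightarrow> 'g"
  where "nr_bracket \<alpha> sg m n P Q =
    contraction \<alpha> sg m n P Q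
      - fun_scale sg ((-1) ^ ((m - 1) * (n - 1))) (contraction \<alpha> sg n m Q P)"

definition cup_bracket ::
    "('k::field \<Rightarrow> 'h::ab_group_add \<Rightarrow> 'h) \<Rightarrow> ('h \<Rightarrow> 'h \<Rightarrow> 'h) \<Rightarrow> ('h \<Rightarrow> 'h) \<Rightarrow> nat \<Rightarrow> nat \<Rightarrow>
     ('g list \<Rightarrow> 'h) \<Rightarrow> ('g list \<Rightarrow> 'h) \<Rightarrow> 'g list \<Rightarrow> 'h"
  where "cup_bracket sh brh \<beta> m n P Q = (\<lambda>xs.
    if length xs = m + n
    then \<Sum>\<sigma>\<in>Sh m n. sh (of_int (sign \<sigma>))
      (brh ((\<beta> ^^ (n - 1)) (P (map (\<lambda>i. xs ! \<sigma> i) [0..<m])))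
           ((\<beta> ^^ (m - 1)) (Q (map (\<lambda>i. xs ! \<sigma> i) [m..<m + n]))))
    else 0)"

definition semidirect_scale ::
    "('k::field \<Rightarrow> 'g::ab_group_add \<Rightarrow> 'g) \<Rightarrow> ('k \<Rightarrow> 'h::ab_group_add \<Rightarrow> 'h) \<Rightarrow>
     'k \<Rightarrow> ('g list \<Rightarrow> 'g) \<times> ('g list \<Rightarrow> 'h) \<Rightarrow> ('g list \<Rightarrow> 'g) \<times> ('g list \<Rightarrow> 'h)"
  where "semidirect_scale sg sh = module_prod.scale (fun_scale sg) (fun_scale sh)"

definition C_semidirect ::
    "('k::field \<Rightarrow> 'g::ab_group_add \<Rightarrow> 'g) \<Rightarrow> ('g \<Rightarrow> 'g) \<Rightarrow>
     ('k \<Rightarrow> 'h::ab_group_add \<Rightarrow> 'h) \<Rightarrow> ('h \<Rightarrow> 'h) \<Rightarrow> nat \<Rightarrow>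
     (('g list \<Rightarrow> 'g) \<times> ('g list \<Rightarrow> 'h)) set"
  where "C_semidirect sg \<alpha> sh \<beta> m = C_gg sg \<alpha> m \<times> C_gh sg \<alpha> sh \<beta> m"

text \<open>From here on \<open>m\<close> and \<open>n\<close> are degrees, so \<open>P\<close> and \<open>Q\<close> have arities \<open>m + 1\<close> and \<open>n + 1\<close>.\<close>

definition ltimes_homogeneous ::
    "('k::field \<Rightarrow> 'g::ab_group_add \<Rightarrow> 'g) \<Rightarrow> ('g \<Rightarrow> 'g) \<Rightarrow>
     ('k \<Rightarrow> 'h::ab_group_add \<Rightarrow> 'h) \<Rightarrow> ('h \<Rightarrow> 'h \<Rightarrow> 'h) \<Rightarrow> ('h \<Rightarrow> 'h) \<Rightarrow> nat \<Rightarrow> nat \<Rightarrow>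
     ('g list \<Rightarrow> 'g) \<times> ('g list \<Rightarrow> 'h) \<Rightarrow> ('g list \<Rightarrow> 'g) \<times> ('g list \<Rightarrow> 'h) \<Rightarrow>
     ('g list \<Rightarrow> 'g) \<times> ('g list \<Rightarrow> 'h)"
  where "ltimes_homogeneous sg \<alpha> sh brh \<beta> m n = (\<lambda>(P, E) (Q, F).
    (nr_bracket \<alpha> sg (m + 1) (n + 1) P Q,
     cup_bracket sh brh \<beta> m n E F + contraction \<alpha> sh (m + 1) n P F
       - fun_scale sh ((-1) ^ (m * n)) (contraction \<alpha> sh (n + 1) m Q E)))"

definition nr_total ::
    "('k::field \<Rightarrow> 'g::ab_group_add \<Rightarrow> 'g) \<Rightarrow> ('g \<Rightarrow> 'g) \<Rightarrow>
     ('g list \<Rightarrow> 'g) \<Rightarrow> ('g list \<Rightarrow> 'g) \<Rightarrow> 'g list \<Rightarrow> 'g"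
  where "nr_total sg \<alpha> =
    bilinear_extension (\<lambda>m. arity_part (m + 1)) (\<lambda>m n. nr_bracket \<alpha> sg (m + 1) (n + 1))"

definition ltimes_total ::
    "('k::field \<Rightarrow> 'g::ab_group_add \<Rightarrow> 'g) \<Rightarrow> ('g \<Rightarrow> 'g) \<Rightarrow>
     ('k \<Rightarrow> 'h::ab_group_add \<Rightarrow> 'h) \<Rightarrow> ('h \<Rightarrow> 'h \<Rightarrow> 'h) \<Rightarrow> ('h \<Rightarrow> 'h) \<Rightarrow>
     ('g list \<Rightarrow> 'g) \<times> ('g list \<Rightarrow> 'h) \<Rightarrow> ('g list \<Rightarrow> 'g) \<times> ('g list \<Rightarrow> 'h) \<Rightarrow>
     ('g list \<Rightarrow> 'g) \<times> ('g list \<Rightarrow> 'h)"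
  where "ltimes_total sg \<alpha> sh brh \<beta> =
    bilinear_extension (\<lambda>m (P, E). (arity_part (m + 1) P, arity_part m E))
      (ltimes_homogeneous sg \<alpha> sh brh \<beta>)"

end

theory Submission
  imports Defs
begin

text \<open>
  A sum over shuffles is an evaluation of the unshuffle coproduct of the exterior algebra, and this
  coproduct is coassociative and graded cocommutative. These two laws carry the proof. Here the
  coproduct is the function \<open>unshuffle_sum\<close>, defined by recursion on the list of arguments: the head
  of the list goes to the first or to the second block. Both laws (\<open>unshuffle_sum_coassoc\<close>,
  \<open>unshuffle_sum_commute\<close>) follow by induction on the list, and \<open>sum_Sh_eq_unshuffle_sum\<close>
  identifies the recursion with the sum over shuffle permutations. The recursion also shows that the
  sum over splittings is alternating if the summand is alternating in each block
  (\<open>alternating_multilinear_unshuffle_sum\<close>), so contractions and brackets of cochains are cochains.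

  Let \<open>P\<close>, \<open>Q\<close> have degrees \<open>m\<close>, \<open>n\<close>, that is, arities \<open>m + 1\<close>, \<open>n + 1\<close>. In \<open>i\<^sub>P (i\<^sub>Q F)\<close> the value
  of \<open>P\<close> is the head of an argument list of \<open>i\<^sub>Q F\<close>, so one step of the recursion splits the expression
  into two parts: \<open>P\<close> feeds \<open>Q\<close>, which by coassociativity gives the insertion of \<open>i\<^sub>P Q\<close> into \<open>F\<close>, or
  \<open>P\<close> and \<open>Q\<close> feed \<open>F\<close> side by side. The second part is graded symmetric in \<open>P\<close> and \<open>Q\<close> by
  cocommutativity and the alternation of \<open>F\<close>; the powers of \<open>\<alpha>\<close> agree because \<open>P\<close> and \<open>Q\<close> commute with
  \<open>\<alpha>\<close>. Hence insertion is a representation of the Nijenhuis-Richardson bracket (\<open>insertion_nr\<close>).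
  Applied to operators in place of \<open>F\<close>, this is the graded pre-Lie identity, from which the graded
  Jacobi identity of the bracket follows (\<open>nr_jacobi\<close>).

  The same splitting applied to \<open>i\<^sub>P [E, F]\<close> shows that \<open>i\<^sub>P\<close> is a graded derivation of the cup product
  bracket (\<open>insertion_cup\<close>). The cup product bracket is itself a graded Lie bracket
  (\<open>cup_skew\<close>, \<open>cup_jacobi\<close>): after reordering the three blocks, its Jacobi identity is the
  Hom-Jacobi identity of the target under the sum. A graded Lie algebra acting by derivations on
  another one gives a semidirect product (\<open>ltimes_jacobi\<close>), which contains the acting algebra as a
  subalgebra and the other one as an ideal.
\<close>

section \<open>Signs\<close>

text \<open>
  Multiplication by \<open>(-1)\<^sup>k\<close>. It needs no scalars, so sums over splittings make sense in every
  abelian group and commute with every additive map.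
\<close>

definition signed :: "nat \<Rightarrow> 'a::ab_group_add \<Rightarrow> 'a"
  where "signed k v = (if even k then v else - v)"

lemma signed_simps [simp]:
  "signed 0 v = v" "signed (Suc k) v = - signed k v" "signed k 0 = 0" "signed k (- v) = - signed k v"
  by (auto simp: signed_def)

lemma signed_add_right: "signed k (v + w) = signed k v + signed k w"
  by (simp add: signed_def)

lemma signed_signed: "signed k (signed l v) = signed (k + l) v"
  by (auto simp: signed_def)

lemma (in vector_space) scale_neg_one_power: "scale ((-1) ^ k) v = signed k v"
  by (cases "even k") (auto simp: signed_def)

lemma (in vector_space) scale_signed: "scale c (signed k v) = signed k (scale c v)"
  by (simp add: signed_def)

section \<open>Sums over splittings of a list\<close>

text \<open>
  The component of the unshuffle coproduct whose first block has length \<open>m\<close>, evaluated on \<open>\<phi>\<close>. If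
  the head of the list goes to the second block, then it passes all entries of the first block; this
  is the sign in the last equation.
\<close>

fun unshuffle_sum :: "nat \<Rightarrow> ('a list \<Rightarrow> 'a list \<Rightarrow> 'v::ab_group_add) \<Rightarrow> 'a list \<Rightarrow> 'v" where
  "unshuffle_sum m \<phi> [] = (if m = 0 then \<phi> [] [] else 0)"
| "unshuffle_sum 0 \<phi> (x # xs) = unshuffle_sum 0 (\<lambda>ys zs. \<phi> ys (x # zs)) xs"
| "unshuffle_sum (Suc m) \<phi> (x # xs) =
     unshuffle_sum m (\<lambda>ys. \<phi> (x # ys)) xs
     + signed (Suc m) (unshuffle_sum (Suc m) (\<lambda>ys zs. \<phi> ys (x # zs)) xs)"

lemma unshuffle_sum_cong:
  assumes "\<And>ys zs. length ys = m \<Longrightarrow> length ys + length zs = length xs \<Longrightarrow> \<phi> ys zs = \<psi> ys zs"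
  shows "unshuffle_sum m \<phi> xs = unshuffle_sum m \<psi> xs"
  using assms
proof (induction m \<phi> xs arbitrary: \<psi> rule: unshuffle_sum.induct)
  case (3 m \<phi> x xs)
  have "unshuffle_sum m (\<lambda>ys. \<phi> (x # ys)) xs = unshuffle_sum m (\<lambda>ys. \<psi> (x # ys)) xs"
    by (rule "3.IH"(1)) (use "3.prems" in auto)
  moreover have "unshuffle_sum (Suc m) (\<lambda>ys zs. \<phi> ys (x # zs)) xs
      = unshuffle_sum (Suc m) (\<lambda>ys zs. \<psi> ys (x # zs)) xs"
    by (rule "3.IH"(2)) (use "3.prems" in auto)
  ultimately show ?case by simp
qed auto

lemma unshuffle_sum_zero [simp]: "unshuffle_sum m (\<lambda>ys zs. 0) xs = 0"
proof (induction xs arbitrary: m)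
  case (Cons x xs)
  then show ?case by (cases m) auto
qed simp

lemma unshuffle_sum_eq_0:
  assumes "\<And>ys zs. length ys = m \<Longrightarrow> length ys + length zs = length xs \<Longrightarrow> \<phi> ys zs = 0"
  shows "unshuffle_sum m \<phi> xs = 0"
  using unshuffle_sum_cong[of m xs \<phi> "\<lambda>ys zs. 0"] assms by simp

lemma unshuffle_sum_short: "length xs < m \<Longrightarrow> unshuffle_sum m \<phi> xs = 0"
  by (rule unshuffle_sum_eq_0) auto

lemma unshuffle_sum_add:
  "unshuffle_sum m (\<lambda>ys zs. \<phi> ys zs + \<psi> ys zs) = (\<lambda>xs. unshuffle_sum m \<phi> xs + unshuffle_sum m \<psi> xs)"
proof
  show "unshuffle_sum m (\<lambda>ys zs. \<phi> ys zs + \<psi> ys zs) xs = unshuffle_sum m \<phi> xs + unshuffle_sum m \<psi> xs"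
    for xs
    by (induction m \<phi> xs arbitrary: \<psi> rule: unshuffle_sum.induct) (auto simp: signed_add_right)
qed

lemma additive_unshuffle_sum:
  assumes "additive h"
  shows "h (unshuffle_sum m \<phi> xs) = unshuffle_sum m (\<lambda>ys zs. h (\<phi> ys zs)) xs"
proof -
  interpret additive h by fact
  show ?thesis
    by (induction m \<phi> xs rule: unshuffle_sum.induct) (auto simp: zero add minus signed_def)
qed

lemma signed_unshuffle_sum:
  "signed k (unshuffle_sum m \<phi> xs) = unshuffle_sum m (\<lambda>ys zs. signed k (\<phi> ys zs)) xs"
  by (rule additive_unshuffle_sum) (simp add: additive_def signed_add_right)

lemma minus_unshuffle_sum:
  "- unshuffle_sum m \<phi> xs = unshuffle_sum m (\<lambda>ys zs. - \<phi> ys zs) xs"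
  by (rule additive_unshuffle_sum) (simp add: additive_def)

lemma unshuffle_sum_uminus:
  "unshuffle_sum m (\<lambda>ys zs. - \<phi> ys zs) = (\<lambda>xs. - unshuffle_sum m \<phi> xs)"
  by (simp add: fun_eq_iff minus_unshuffle_sum)

lemma unshuffle_sum_map:
  "unshuffle_sum m \<phi> (map f xs) = unshuffle_sum m (\<lambda>ys zs. \<phi> (map f ys) (map f zs)) xs"
  by (induction m "\<lambda>ys zs. \<phi> (map f ys) (map f zs)" xs arbitrary: \<phi> rule: unshuffle_sum.induct) auto

text \<open>
  Both sides distribute the entries over three blocks, of which the first two have lengths \<open>p\<close> and
  \<open>q\<close>. In the induction the sign of an entry that goes to the third block arises in one step of
  length \<open>p + q\<close> on the left and in two steps of lengths \<open>p\<close> and \<open>q\<close> on the right.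
\<close>

lemma unshuffle_sum_coassoc:
  fixes \<phi> :: "'a list \<Rightarrow> 'a list \<Rightarrow> 'a list \<Rightarrow> 'v::ab_group_add"
  shows "unshuffle_sum (p + q) (\<lambda>ws cs. unshuffle_sum p (\<lambda>as bs. \<phi> as bs cs) ws) xs
    = unshuffle_sum p (\<lambda>as ws. unshuffle_sum q (\<phi> as) ws) xs"
proof (induction xs arbitrary: p q \<phi>)
  case Nil
  then show ?case by auto
next
  case (Cons x xs)
  note IH = Cons.IH
  show ?case
  proof (cases p)
    case 0
    show ?thesis
    proof (cases q)
      case 0
      then show ?thesis using \<open>p = 0\<close> IH[of 0 0] by simp
    next
      case (Suc q')
      then show ?thesis using \<open>p = 0\<close> IH[of 0 q'] IH[of 0 "Suc q'"]
        by (simp add: unshuffle_sum_add signed_unshuffle_sum)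
    qed
  next
    case (Suc p')
    show ?thesis
    proof (cases q)
      case 0
      \<comment> \<open>A block of length \<open>p'\<close> is too short for a part of length \<open>p' + 1\<close>.\<close>
      have "unshuffle_sum p' (\<lambda>ws cs. unshuffle_sum (Suc p') (\<psi> cs) ws) xs = 0"
        for \<psi> :: "'a list \<Rightarrow> 'a list \<Rightarrow> 'a list \<Rightarrow> 'v"
        by (intro unshuffle_sum_eq_0) (auto intro: unshuffle_sum_short)
      then show ?thesis using 0 \<open>p = Suc p'\<close> IH[of p' 0] IH[of "Suc p'" 0]
        by (simp add: unshuffle_sum_add signed_unshuffle_sum)
    next
      case (Suc q')
      then show ?thesis using \<open>p = Suc p'\<close> IH[of p' "Suc q'"] IH[of "Suc p'" q'] IH[of "Suc p'" "Suc q'"]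
        by (simp add: unshuffle_sum_add signed_unshuffle_sum minus_unshuffle_sum signed_add_right
            signed_signed add.commute)
    qed
  qed
qed

text \<open>
  Exchanging two blocks of lengths \<open>m\<close> and \<open>n\<close> takes \<open>m * n\<close> transpositions. The length of the
  list makes the second block have length \<open>n\<close>.
\<close>

lemma unshuffle_sum_commute:
  fixes \<phi> :: "'a list \<Rightarrow> 'a list \<Rightarrow> 'v::ab_group_add"
  assumes "length xs = m + n"
  shows "unshuffle_sum m \<phi> xs = signed (m * n) (unshuffle_sum n (\<lambda>ys zs. \<phi> zs ys) xs)"
  using assms
proof (induction xs arbitrary: m n \<phi>)
  case Nil
  then show ?case by auto
next
  case (Cons x xs)
  note IH = Cons.IH
  show ?case
  proof (cases m)
    case 0
    then obtain n' where n: "n = Suc n'" using Cons.prems by (cases n) auto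
    have "unshuffle_sum (Suc n') (\<lambda>ys zs. \<phi> (x # zs) ys) xs = 0"
      "unshuffle_sum (Suc n') (\<lambda>ys zs. \<phi> zs ys) xs = 0"
      for \<phi> :: "'a list \<Rightarrow> 'a list \<Rightarrow> 'v"
      by (rule unshuffle_sum_eq_0; use Cons.prems 0 n in auto)+
    then show ?thesis using 0 n IH[of 0 n'] Cons.prems by simp
  next
    case (Suc m')
    show ?thesis
    proof (cases n)
      case 0
      have "unshuffle_sum (Suc m') (\<lambda>ys zs. \<phi> ys (x # zs)) xs = 0"
        by (rule unshuffle_sum_eq_0; use Cons.prems 0 Suc in auto)+
      then show ?thesis using Suc 0 IH[of m' 0] Cons.prems by simp
    next
      case n: (Suc n')
      then show ?thesis
        using IH[of m' "Suc n'" "\<lambda>ys. \<phi> (x # ys)"] IH[of "Suc m'" n' "\<lambda>ys zs. \<phi> ys (x # zs)"]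
          Suc Cons.prems
        by (auto simp: signed_def)
    qed
  qed
qed

text \<open>
  Among three blocks the first two can be exchanged: coassociativity joins them to one block, on
  which cocommutativity applies.
\<close>

lemma unshuffle_sum_exchange:
  "unshuffle_sum p (\<lambda>as ws. unshuffle_sum q (\<lambda>bs cs. \<phi> as bs cs) ws) xs
    = signed (p * q) (unshuffle_sum q (\<lambda>bs ws. unshuffle_sum p (\<lambda>as cs. \<phi> as bs cs) ws) xs)"
proof -
  have "unshuffle_sum p (\<lambda>as ws. unshuffle_sum q (\<lambda>bs cs. \<phi> as bs cs) ws) xs
    = unshuffle_sum (q + p) (\<lambda>ws cs. unshuffle_sum p (\<lambda>as bs. \<phi> as bs cs) ws) xs"
    by (simp add: unshuffle_sum_coassoc[symmetric] add.commute)
  also have "\<dots> = unshuffle_sum (q + p)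
      (\<lambda>ws cs. signed (p * q) (unshuffle_sum q (\<lambda>bs as. \<phi> as bs cs) ws)) xs"
    by (intro unshuffle_sum_cong unshuffle_sum_commute) auto
  also have "\<dots> = signed (p * q) (unshuffle_sum q (\<lambda>bs ws. unshuffle_sum p (\<lambda>as cs. \<phi> as bs cs) ws) xs)"
    by (simp only: signed_unshuffle_sum[symmetric] unshuffle_sum_coassoc)
  finally show ?thesis .
qed

section \<open>Shuffle permutations and splittings\<close>

text \<open>
  A shuffle of \<open>N + 1\<close> positions arises from one of \<open>N\<close> positions in two ways: by \<open>lift_perm\<close> if the
  smallest value lies in the first block, and by \<open>lift_perm\<close> followed by moving that value to the start
  of the second block, which is composition with \<open>front_cycle\<close>. These are the two summands in the
  recursion of \<open>unshuffle_sum\<close>, and the sign of the cycle is the sign there.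
\<close>

definition lift_perm :: "(nat \<Rightarrow> nat) \<Rightarrow> nat \<Rightarrow> nat"
  where "lift_perm \<sigma> = case_nat 0 (\<lambda>i. Suc (\<sigma> i))"

definition front_cycle :: "nat \<Rightarrow> nat \<Rightarrow> nat"
  where "front_cycle m i = (if i < m then Suc i else if i = m then 0 else i)"

lemma lift_perm_simps [simp]: "lift_perm \<sigma> 0 = 0" "lift_perm \<sigma> (Suc i) = Suc (\<sigma> i)"
  by (auto simp: lift_perm_def)

lemma sign_lift_perm:
  assumes "\<sigma> permutes {0..<N}"
  shows "lift_perm \<sigma> permutes {0..<Suc N}" and "sign (lift_perm \<sigma>) = sign \<sigma>"
proof -
  have "lift_perm \<sigma> permutes {0..<Suc N} \<and> sign (lift_perm \<sigma>) = sign \<sigma>"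
    using assms finite_atLeastLessThan
  proof (induction rule: permutes_induct)
    case id
    have "lift_perm id = id" by (auto simp: fun_eq_iff lift_perm_def split: nat.splits)
    then show ?case by (metis permutes_id)
  next
    case (swap a b p)
    have eq: "lift_perm (Transposition.transpose a b \<circ> p)
        = Transposition.transpose (Suc a) (Suc b) \<circ> lift_perm p"
      by (auto simp: fun_eq_iff lift_perm_def Transposition.transpose_def split: nat.splits)
    have per: "permutation (lift_perm p)" "permutation p"
      using swap permutation_permutes by blast+
    show ?case
    proof
      show "lift_perm (Transposition.transpose a b \<circ> p) permutes {0..<Suc N}"
        unfolding eq using swap by (intro permutes_compose permutes_swap_id) auto
      show "sign (lift_perm (Transposition.transpose a b \<circ> p))
          = sign (Transposition.transpose a b \<circ> p)"
        unfolding eq using swap per by (simp only: sign_compose permutation_swap_id sign_swap_id) simp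
    qed
  qed
  then show "lift_perm \<sigma> permutes {0..<Suc N}" and "sign (lift_perm \<sigma>) = sign \<sigma>" by auto
qed

lemma sign_front_cycle:
  shows "front_cycle m permutes {0..<Suc m}" and "sign (front_cycle m) = (-1) ^ m"
proof (induction m)
  have "front_cycle 0 = id" by (auto simp: fun_eq_iff front_cycle_def)
  then show "front_cycle 0 permutes {0..<Suc 0}" and "sign (front_cycle 0) = (-1) ^ 0"
    by (simp_all only: permutes_id sign_id power_0)
next
  fix m
  assume 1: "front_cycle m permutes {0..<Suc m}" and 2: "sign (front_cycle m) = (-1) ^ m"
  have eq: "front_cycle (Suc m) = front_cycle m \<circ> Transposition.transpose m (Suc m)"
    by (auto simp: fun_eq_iff front_cycle_def Transposition.transpose_def)
  show "front_cycle (Suc m) permutes {0..<Suc (Suc m)}"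
    unfolding eq using 1 by (intro permutes_compose permutes_swap_id) (auto intro: permutes_subset)
  have "permutation (front_cycle m)"
    using 1 permutation_permutes by blast
  then show "sign (front_cycle (Suc m)) = (-1) ^ Suc m"
    unfolding eq using 2 by (simp only: sign_compose permutation_swap_id sign_swap_id) simp
qed

text \<open>
  The converse of \<open>sign_lift_perm\<close>: a permutation that fixes \<open>0\<close> restricts to the positive numbers.
\<close>

lemma permutes_fix_0_imp_lift_perm:
  assumes "\<sigma> permutes {0..<Suc N}" and "\<sigma> 0 = 0"
  obtains \<tau> where "\<tau> permutes {0..<N}" and "\<sigma> = lift_perm \<tau>"
proof
  have inj: "\<sigma> i = \<sigma> j \<longleftrightarrow> i = j" for i j
    using permutes_inj[OF assms(1)] by (auto dest: injD)
  have pos: "\<sigma> (Suc i) \<noteq> 0" for i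
    using inj[of "Suc i" 0] assms(2) by simp
  show eq: "\<sigma> = lift_perm (\<lambda>i. \<sigma> (Suc i) - 1)"
    using assms(2) pos by (auto simp: fun_eq_iff lift_perm_def split: nat.splits)
  have "\<sigma> (Suc i) - 1 = i" if "i \<notin> {0..<N}" for i
    using that assms(1) by (simp add: permutes_def)
  moreover have "\<exists>!i. \<sigma> (Suc i) - 1 = j" for j
  proof -
    obtain i where i: "\<sigma> i = Suc j"
      using permutes_surj[OF assms(1)] by (metis surjD)
    then obtain i' where "i = Suc i'" using assms(2) by (cases i) auto
    then show ?thesis using i pos inj
      by (metis Suc_pred' diff_Suc_1 neq0_conv nat.inject)
  qed
  ultimately show "(\<lambda>i. \<sigma> (Suc i) - 1) permutes {0..<N}"
    unfolding permutes_def by blast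
qed

lemma Sh_first_fixed:
  "{\<sigma> \<in> Sh (Suc m) n. \<sigma> 0 = 0} = lift_perm ` Sh m n"
proof (intro equalityI subsetI)
  fix \<sigma> assume "\<sigma> \<in> {\<sigma> \<in> Sh (Suc m) n. \<sigma> 0 = 0}"
  then have \<sigma>: "\<sigma> permutes {0..<Suc (m + n)}" "strict_mono_on {0..<Suc m} \<sigma>"
      "strict_mono_on {Suc m..<Suc (m + n)} \<sigma>" "\<sigma> 0 = 0"
    by (auto simp: Sh_def)
  then obtain \<tau> where \<tau>: "\<tau> permutes {0..<m + n}" "\<sigma> = lift_perm \<tau>"
    using permutes_fix_0_imp_lift_perm by blast
  have "strict_mono_on {0..<m} \<tau>"
  proof (rule strict_mono_onI)
    fix i j assume "i \<in> {0..<m}" "j \<in> {0..<m}" "i < j"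
    then show "\<tau> i < \<tau> j" using strict_mono_onD[OF \<sigma>(2), of "Suc i" "Suc j"] \<tau>(2) by auto
  qed
  moreover have "strict_mono_on {m..<m + n} \<tau>"
  proof (rule strict_mono_onI)
    fix i j assume "i \<in> {m..<m + n}" "j \<in> {m..<m + n}" "i < j"
    then show "\<tau> i < \<tau> j" using strict_mono_onD[OF \<sigma>(3), of "Suc i" "Suc j"] \<tau>(2) by auto
  qed
  ultimately show "\<sigma> \<in> lift_perm ` Sh m n" using \<tau> by (auto simp: Sh_def)
next
  fix \<sigma> assume "\<sigma> \<in> lift_perm ` Sh m n"
  then obtain \<tau> where \<tau>: "\<tau> permutes {0..<m + n}" "strict_mono_on {0..<m} \<tau>"
      "strict_mono_on {m..<m + n} \<tau>" "\<sigma> = lift_perm \<tau>"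
    by (auto simp: Sh_def)
  have "strict_mono_on {0..<Suc m} \<sigma>"
  proof (rule strict_mono_onI)
    fix i j assume "i \<in> {0..<Suc m}" "j \<in> {0..<Suc m}" "i < j"
    then show "\<sigma> i < \<sigma> j"
      using strict_mono_onD[OF \<tau>(2), of "i - 1" "j - 1"] \<tau>(4) by (cases i; cases j) auto
  qed
  moreover have "strict_mono_on {Suc m..<Suc m + n} \<sigma>"
  proof (rule strict_mono_onI)
    fix i j assume "i \<in> {Suc m..<Suc m + n}" "j \<in> {Suc m..<Suc m + n}" "i < j"
    then show "\<sigma> i < \<sigma> j"
      using strict_mono_onD[OF \<tau>(3), of "i - 1" "j - 1"] \<tau>(4) by (cases i; cases j) auto
  qed
  ultimately show "\<sigma> \<in> {\<sigma> \<in> Sh (Suc m) n. \<sigma> 0 = 0}"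
    using \<tau>(4) sign_lift_perm(1)[OF \<tau>(1)] by (simp add: Sh_def)
qed

lemma Sh_second_fixed:
  "{\<sigma> \<in> Sh m (Suc n). \<sigma> m = 0} = (\<lambda>\<sigma>. lift_perm \<sigma> \<circ> front_cycle m) ` Sh m n"
proof (intro equalityI subsetI)
  fix \<sigma> assume "\<sigma> \<in> {\<sigma> \<in> Sh m (Suc n). \<sigma> m = 0}"
  then have \<sigma>: "\<sigma> permutes {0..<Suc (m + n)}" "strict_mono_on {0..<m} \<sigma>"
      "strict_mono_on {m..<Suc (m + n)} \<sigma>" "\<sigma> m = 0"
    by (auto simp: Sh_def)
  have fc: "front_cycle m permutes {0..<Suc (m + n)}"
    using sign_front_cycle(1) by (rule permutes_subset) auto
  have "inv (front_cycle m) 0 = m"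
    using permutes_inv_eq[OF fc] by (simp add: front_cycle_def)
  then obtain \<tau> where \<tau>: "\<tau> permutes {0..<m + n}" "\<sigma> \<circ> inv (front_cycle m) = lift_perm \<tau>"
    using permutes_fix_0_imp_lift_perm[OF permutes_compose[OF permutes_inv[OF fc] \<sigma>(1)]] \<sigma>(4)
    by auto
  then have eq: "\<sigma> = lift_perm \<tau> \<circ> front_cycle m"
    using permutes_inv_o(2)[OF fc] by (metis comp_assoc comp_id)
  have **: "\<sigma> i = Suc (\<tau> i)" if "i < m" for i
    using that by (simp add: eq front_cycle_def)
  have "strict_mono_on {0..<m} \<tau>"
  proof (rule strict_mono_onI)
    fix i j assume "i \<in> {0..<m}" "j \<in> {0..<m}" "i < j"
    then show "\<tau> i < \<tau> j" using strict_mono_onD[OF \<sigma>(2), of i j] **[of i] **[of j] by auto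
  qed
  moreover have *: "\<sigma> (Suc i) = Suc (\<tau> i)" if "i \<ge> m" for i
    using that by (simp add: eq front_cycle_def)
  have "strict_mono_on {m..<m + n} \<tau>"
  proof (rule strict_mono_onI)
    fix i j assume "i \<in> {m..<m + n}" "j \<in> {m..<m + n}" "i < j"
    then show "\<tau> i < \<tau> j" using strict_mono_onD[OF \<sigma>(3), of "Suc i" "Suc j"] *[of i] *[of j] by auto
  qed
  ultimately have "\<tau> \<in> Sh m n" using \<tau>(1) by (auto simp: Sh_def)
  with eq show "\<sigma> \<in> (\<lambda>\<sigma>. lift_perm \<sigma> \<circ> front_cycle m) ` Sh m n" by blast
next
  fix \<sigma> assume "\<sigma> \<in> (\<lambda>\<sigma>. lift_perm \<sigma> \<circ> front_cycle m) ` Sh m n"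
  then obtain \<tau> where \<tau>: "\<tau> permutes {0..<m + n}" "strict_mono_on {0..<m} \<tau>"
      "strict_mono_on {m..<m + n} \<tau>" "\<sigma> = lift_perm \<tau> \<circ> front_cycle m"
    by (auto simp: Sh_def)
  have fc: "front_cycle m permutes {0..<Suc (m + n)}"
    using sign_front_cycle(1) by (rule permutes_subset) auto
  have "\<sigma> permutes {0..<m + Suc n}"
    unfolding \<tau>(4) using permutes_compose[OF fc sign_lift_perm(1)[OF \<tau>(1)]] by simp
  moreover have "strict_mono_on {0..<m} \<sigma>"
  proof (rule strict_mono_onI)
    fix i j assume "i \<in> {0..<m}" "j \<in> {0..<m}" "i < j"
    then show "\<sigma> i < \<sigma> j"
      using strict_mono_onD[OF \<tau>(2), of i j] by (simp add: \<tau>(4) front_cycle_def)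
  qed
  moreover have "strict_mono_on {m..<m + Suc n} \<sigma>"
  proof (rule strict_mono_onI)
    fix i j assume ij: "i \<in> {m..<m + Suc n}" "j \<in> {m..<m + Suc n}" "i < j"
    then obtain j' where j': "j = Suc j'" "j' \<ge> m" by (cases j) auto
    show "\<sigma> i < \<sigma> j"
    proof (cases "i = m")
      case True
      then show ?thesis using j' by (simp add: \<tau>(4) front_cycle_def)
    next
      case False
      then obtain i' where i': "i = Suc i'" "i' \<ge> m" using ij by (cases i) auto
      then show ?thesis using j' ij strict_mono_onD[OF \<tau>(3), of i' j']
        by (simp add: \<tau>(4) front_cycle_def)
    qed
  qed
  ultimately show "\<sigma> \<in> {\<sigma> \<in> Sh m (Suc n). \<sigma> m = 0}"
    by (simp add: Sh_def \<tau>(4) front_cycle_def)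
qed

text \<open>
  Both blocks of a shuffle are increasing, so the value \<open>0\<close> can only be taken at the start of one of
  them.
\<close>

lemma Sh_cases:
  assumes "\<sigma> \<in> Sh m n" and "m + n > 0"
  shows "m > 0 \<and> \<sigma> 0 = 0 \<or> n > 0 \<and> \<sigma> m = 0"
proof -
  have \<sigma>: "\<sigma> permutes {0..<m + n}" "strict_mono_on {0..<m} \<sigma>" "strict_mono_on {m..<m + n} \<sigma>"
    using assms by (auto simp: Sh_def)
  obtain i where i: "\<sigma> i = 0" using permutes_surj[OF \<sigma>(1)] by (metis surjD)
  moreover have "i < m + n" using i \<sigma>(1) assms(2) by (metis atLeastLessThan_iff permutes_in_image zero_le)
  ultimately show ?thesis
    using strict_mono_onD[OF \<sigma>(2), of 0 i] strict_mono_onD[OF \<sigma>(3), of m i]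
    by (cases "i < m"; cases "i = 0"; cases "i = m") auto
qed

lemma finite_Sh: "finite (Sh m n)"
  by (rule finite_subset[OF _ finite_permutations[of "{0..<m + n}"]]) (auto simp: Sh_def)

lemma inj_lift_perm: "inj lift_perm"
  by (rule injI) (metis ext lift_perm_simps(2) nat.inject)

context vector_space
begin

text \<open>
  By induction on the list: the shuffles that send \<open>0\<close> to \<open>0\<close> and those that send \<open>m\<close> to \<open>0\<close> give the
  two summands of the recursion.
\<close>

lemma sum_Sh_eq_unshuffle_sum:
  assumes "length xs = m + n"
  shows "(\<Sum>\<sigma>\<in>Sh m n. scale (of_int (sign \<sigma>))
      (\<phi> (map (\<lambda>i. xs ! \<sigma> i) [0..<m]) (map (\<lambda>i. xs ! \<sigma> i) [m..<m + n]))) = unshuffle_sum m \<phi> xs"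
  using assms
proof (induction xs arbitrary: m n \<phi>)
  case Nil
  have "Sh 0 0 = {id}" by (auto simp: Sh_def)
  then show ?case using Nil by simp
next
  case (Cons x xs)
  let ?t = "\<lambda>m n \<phi> xs \<sigma>. scale (of_int (sign \<sigma>))
      (\<phi> (map (\<lambda>i. xs ! \<sigma> i) [0..<m]) (map (\<lambda>i. xs ! \<sigma> i) [m..<m + n]))"
  note IH = Cons.IH
  have first: "(\<Sum>\<sigma> | \<sigma> \<in> Sh (Suc m) n \<and> \<sigma> 0 = 0. ?t (Suc m) n \<phi> (x # xs) \<sigma>)
      = unshuffle_sum m (\<lambda>ys. \<phi> (x # ys)) xs" if "length xs = m + n" for m n \<phi>
  proof -
    have "(\<Sum>\<sigma> | \<sigma> \<in> Sh (Suc m) n \<and> \<sigma> 0 = 0. ?t (Suc m) n \<phi> (x # xs) \<sigma>)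
        = (\<Sum>\<sigma>\<in>Sh m n. ?t (Suc m) n \<phi> (x # xs) (lift_perm \<sigma>))"
      unfolding Sh_first_fixed using inj_on_subset[OF inj_lift_perm] by (subst sum.reindex) auto
    also have "\<dots> = (\<Sum>\<sigma>\<in>Sh m n. ?t m n (\<lambda>ys. \<phi> (x # ys)) xs \<sigma>)"
    proof (rule sum.cong[OF refl])
      fix \<sigma> assume "\<sigma> \<in> Sh m n"
      then have "sign (lift_perm \<sigma>) = sign \<sigma>" using sign_lift_perm by (auto simp: Sh_def)
      moreover have "map (\<lambda>i. (x # xs) ! lift_perm \<sigma> i) [0..<Suc m]
          = x # map (\<lambda>i. xs ! \<sigma> i) [0..<m]"
        by (subst map_upt_Suc) simp
      moreover have "map (\<lambda>i. (x # xs) ! lift_perm \<sigma> i) [Suc m..<Suc m + n]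
          = map (\<lambda>i. xs ! \<sigma> i) [m..<m + n]"
        by (simp only: add_Suc map_Suc_upt[symmetric] map_map) simp
      ultimately show "?t (Suc m) n \<phi> (x # xs) (lift_perm \<sigma>) = ?t m n (\<lambda>ys. \<phi> (x # ys)) xs \<sigma>"
        by simp
    qed
    finally show ?thesis using IH[OF that] by simp
  qed
  have second: "(\<Sum>\<sigma> | \<sigma> \<in> Sh m (Suc n) \<and> \<sigma> m = 0. ?t m (Suc n) \<phi> (x # xs) \<sigma>)
      = signed m (unshuffle_sum m (\<lambda>ys zs. \<phi> ys (x # zs)) xs)" if "length xs = m + n" for m n \<phi>
  proof -
    have fc: "front_cycle m permutes {0..<Suc (m + n)}"
      using sign_front_cycle(1) by (rule permutes_subset) auto
    have "inj (\<lambda>\<sigma>. lift_perm \<sigma> \<circ> front_cycle m)"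
    proof (rule injI)
      fix \<sigma> \<tau> assume eq: "lift_perm \<sigma> \<circ> front_cycle m = lift_perm \<tau> \<circ> front_cycle m"
      have "lift_perm \<rho> = lift_perm \<rho> \<circ> front_cycle m \<circ> inv (front_cycle m)" for \<rho>
        by (simp only: comp_assoc permutes_inv_o(1)[OF fc] comp_id)
      then have "lift_perm \<sigma> = lift_perm \<tau>" using eq by metis
      then show "\<sigma> = \<tau>" using inj_lift_perm by (rule injD[rotated])
    qed
    then have "(\<Sum>\<sigma> | \<sigma> \<in> Sh m (Suc n) \<and> \<sigma> m = 0. ?t m (Suc n) \<phi> (x # xs) \<sigma>)
        = (\<Sum>\<sigma>\<in>Sh m n. ?t m (Suc n) \<phi> (x # xs) (lift_perm \<sigma> \<circ> front_cycle m))"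
      unfolding Sh_second_fixed using inj_on_subset by (subst sum.reindex) auto
    also have "\<dots> = (\<Sum>\<sigma>\<in>Sh m n. scale ((-1) ^ m) (?t m n (\<lambda>ys zs. \<phi> ys (x # zs)) xs \<sigma>))"
    proof (rule sum.cong[OF refl])
      fix \<sigma> assume "\<sigma> \<in> Sh m n"
      then have \<sigma>: "\<sigma> permutes {0..<m + n}" by (auto simp: Sh_def)
      have sgn: "sign (lift_perm \<sigma> \<circ> front_cycle m) = (-1) ^ m * sign \<sigma>"
        using sign_lift_perm[OF \<sigma>] sign_front_cycle[of m]
        by (subst sign_compose) (auto simp: permutation_permutes)
      have left: "map (\<lambda>i. (x # xs) ! (lift_perm \<sigma> \<circ> front_cycle m) i) [0..<m]
          = map (\<lambda>i. xs ! \<sigma> i) [0..<m]"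
        by (auto simp: front_cycle_def)
      have right: "map (\<lambda>i. (x # xs) ! (lift_perm \<sigma> \<circ> front_cycle m) i) [m..<m + Suc n]
          = x # map (\<lambda>i. xs ! \<sigma> i) [m..<m + n]"
      proof -
        have "[m..<m + Suc n] = m # map Suc [m..<m + n]"
          by (simp add: upt_conv_Cons map_Suc_upt del: upt_Suc)
        then show ?thesis by (auto simp: front_cycle_def)
      qed
      show "?t m (Suc n) \<phi> (x # xs) (lift_perm \<sigma> \<circ> front_cycle m)
          = scale ((-1) ^ m) (?t m n (\<lambda>ys zs. \<phi> ys (x # zs)) xs \<sigma>)"
        unfolding sgn left right by simp
    qed
    also have "\<dots> = signed m (unshuffle_sum m (\<lambda>ys zs. \<phi> ys (x # zs)) xs)"
      unfolding scale_sum_right[symmetric] IH[OF that, of "\<lambda>ys zs. \<phi> ys (x # zs)"]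
      by (rule scale_neg_one_power)
    finally show ?thesis .
  qed
  show ?case
  proof (cases m)
    case 0
    then obtain n' where n: "n = Suc n'" using Cons.prems by (cases n) auto
    have "Sh m n = {\<sigma> \<in> Sh m (Suc n'). \<sigma> m = 0}"
      using Sh_cases[of _ m n] 0 n by auto
    then show ?thesis using second[of m n' \<phi>] Cons.prems 0 n by simp
  next
    case m: (Suc m')
    show ?thesis
    proof (cases n)
      case 0
      then have "Sh m n = {\<sigma> \<in> Sh (Suc m') n. \<sigma> 0 = 0}"
        using Sh_cases[of _ m n] m by auto
      moreover have "unshuffle_sum (Suc m') (\<lambda>ys zs. \<phi> ys (x # zs)) xs = 0"
        using Cons.prems 0 m by (intro unshuffle_sum_short) auto
      ultimately show ?thesis using first[of m' n \<phi>] Cons.prems m by simp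
    next
      case n: (Suc n')
      have disj: "{\<sigma> \<in> Sh (Suc m') n. \<sigma> 0 = 0} \<inter> {\<sigma> \<in> Sh m (Suc n'). \<sigma> m = 0} = {}"
        unfolding m by (auto simp: Sh_def dest!: permutes_inj injD[of _ 0 "Suc m'"])
      have split: "Sh m n = {\<sigma> \<in> Sh (Suc m') n. \<sigma> 0 = 0} \<union> {\<sigma> \<in> Sh m (Suc n'). \<sigma> m = 0}"
        unfolding m n using Sh_cases[of _ "Suc m'" "Suc n'"] by blast
      have "(\<Sum>\<sigma>\<in>Sh m n. ?t m n \<phi> (x # xs) \<sigma>)
          = (\<Sum>\<sigma> | \<sigma> \<in> Sh (Suc m') n \<and> \<sigma> 0 = 0. ?t m n \<phi> (x # xs) \<sigma>)
          + (\<Sum>\<sigma> | \<sigma> \<in> Sh m (Suc n') \<and> \<sigma> m = 0. ?t m n \<phi> (x # xs) \<sigma>)"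
        by (subst split, rule sum.union_disjoint) (use disj finite_Sh in simp_all)
      then show ?thesis
        using first[of m' n \<phi>] second[of m n' \<phi>] Cons.prems m n by simp
    qed
  qed
qed

end

section \<open>Alternating multilinear functions on lists\<close>

text \<open>
  The entries to be changed are marked by a decomposition of the list, and alternation is replaced by
  the sign change under exchange of neighbours. In this form all three conditions pass through
  inductions on lists; \<open>alternating_maps_iff\<close> compares them with the usual ones.
\<close>

definition alternating_multilinear ::
    "('k \<Rightarrow> 'g::ab_group_add \<Rightarrow> 'g) \<Rightarrow> ('k \<Rightarrow> 'h::ab_group_add \<Rightarrow> 'h) \<Rightarrow> ('g list \<Rightarrow> 'h) \<Rightarrow> bool"
  where "alternating_multilinear s1 s2 f \<longleftrightarrow>
    (\<forall>us x y vs. f (us @ (x + y) # vs) = f (us @ x # vs) + f (us @ y # vs)) \<and>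
    (\<forall>us c x vs. f (us @ s1 c x # vs) = s2 c (f (us @ x # vs))) \<and>
    (\<forall>us x y vs. f (us @ x # y # vs) = - f (us @ y # x # vs))"

lemma alternating_multilinearD:
  assumes "alternating_multilinear s1 s2 f"
  shows "f (us @ (x + y) # vs) = f (us @ x # vs) + f (us @ y # vs)"
    and "f (us @ s1 c x # vs) = s2 c (f (us @ x # vs))"
    and "f (us @ x # y # vs) = - f (us @ y # x # vs)"
  using assms unfolding alternating_multilinear_def by blast+

lemma alternating_multilinearD_hd:
  assumes "alternating_multilinear s1 s2 f"
  shows "f ((x + y) # vs) = f (x # vs) + f (y # vs)"
    and "f (s1 c x # vs) = s2 c (f (x # vs))"
    and "f (x # y # vs) = - f (y # x # vs)"
  using alternating_multilinearD[OF assms, of "[]"] unfolding append_Nil by blast+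

lemma alternating_multilinear_Cons:
  assumes "alternating_multilinear s1 s2 f"
  shows "alternating_multilinear s1 s2 (\<lambda>xs. f (x # xs))"
  unfolding alternating_multilinear_def
proof (intro conjI allI)
  show "f (x # us @ y # z # vs) = - f (x # us @ z # y # vs)" for us y z vs
    using alternating_multilinearD(3)[OF assms, of "x # us" y z vs] by simp
qed (use alternating_multilinearD(1,2)[OF assms, of "x # us" for us] in simp_all)

lemma alternating_multilinear_map:
  assumes "alternating_multilinear s1 s2 f" and "Vector_Spaces.linear s1 s1 a"
  shows "alternating_multilinear s1 s2 (\<lambda>xs. f (map a xs))"
  unfolding alternating_multilinear_def
proof (intro conjI allI)
  show "f (map a (us @ y # z # vs)) = - f (map a (us @ z # y # vs))" for us y z vs
    using alternating_multilinearD(3)[OF assms(1), of "map a us" "a y" "a z"] by simp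
qed (use alternating_multilinearD(1,2)[OF assms(1), of "map a us" for us] assms(2)
      in \<open>simp_all add: Vector_Spaces.linear_iff\<close>)

lemma alternating_multilinear_linear:
  assumes "alternating_multilinear s1 s2 f" and "Vector_Spaces.linear s2 s3 h"
  shows "alternating_multilinear s1 s3 (\<lambda>xs. h (f xs))"
proof -
  interpret h: module_hom s2 s3 h using assms(2) by (simp add: Vector_Spaces.linear_def)
  show ?thesis
    unfolding alternating_multilinear_def
  proof (intro conjI allI)
    show "h (f (us @ x # y # vs)) = - h (f (us @ y # x # vs))" for us x y vs
      by (subst alternating_multilinearD(3)[OF assms(1)]) (rule h.neg)
  qed (simp_all only: alternating_multilinearD(1,2)[OF assms(1)] h.add h.scale)
qed

lemma linear_funpow:
  assumes "Vector_Spaces.linear s s f"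
  shows "Vector_Spaces.linear s s (f ^^ n)"
  using assms by (induction n) (auto simp: Vector_Spaces.linear_iff)

context vector_space_pair
begin

text \<open>
  The induction consumes the entries before the marked position. If the two neighbours to be exchanged
  stand at the head, then they go to the same block, where \<open>\<phi>\<close> is alternating, or to different blocks;
  the two terms of the latter kind have opposite signs and change places.
\<close>

lemma alternating_multilinear_unshuffle_sum:
  assumes "\<And>zs. alternating_multilinear s1 s2 (\<lambda>ys. \<phi> ys zs)"
    and "\<And>ys. alternating_multilinear s1 s2 (\<phi> ys)"
  shows "alternating_multilinear s1 s2 (unshuffle_sum m \<phi>)"
proof -
  have "unshuffle_sum m \<phi> (us @ (x + y) # vs)
        = unshuffle_sum m \<phi> (us @ x # vs) + unshuffle_sum m \<phi> (us @ y # vs)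
    \<and> unshuffle_sum m \<phi> (us @ s1 c x # vs) = s2 c (unshuffle_sum m \<phi> (us @ x # vs))
    \<and> unshuffle_sum m \<phi> (us @ x # y # vs) = - unshuffle_sum m \<phi> (us @ y # x # vs)"
    for us x y vs c
    using assms
  proof (induction us arbitrary: m \<phi>)
    case Nil
    note l = alternating_multilinearD_hd[OF Nil.prems(1)]
    note r = alternating_multilinearD_hd[OF Nil.prems(2)]
    have l_fun: "\<phi> ((x + y) # ys) = (\<lambda>zs. \<phi> (x # ys) zs + \<phi> (y # ys) zs)"
      "\<phi> (s1 c x # ys) = (\<lambda>zs. s2 c (\<phi> (x # ys) zs))" for x y c ys
      using l(1,2) by auto
    have sc: "s2 c (unshuffle_sum k \<psi> vs) = unshuffle_sum k (\<lambda>ys zs. s2 c (\<psi> ys zs)) vs" for k \<psi>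
      by (rule additive_unshuffle_sum) (simp add: additive_def vs2.scale_right_distrib)
    have ll: "unshuffle_sum k (\<lambda>ys. \<phi> (x # y # ys)) vs = - unshuffle_sum k (\<lambda>ys. \<phi> (y # x # ys)) vs" for k
      unfolding minus_unshuffle_sum by (rule unshuffle_sum_cong) (rule l(3))
    have rr: "unshuffle_sum k (\<lambda>ys zs. \<phi> ys (x # y # zs)) vs
        = - unshuffle_sum k (\<lambda>ys zs. \<phi> ys (y # x # zs)) vs" for k
      unfolding minus_unshuffle_sum by (rule unshuffle_sum_cong) (rule r(3))
    show ?case
    proof (intro conjI)
      show "unshuffle_sum m \<phi> ([] @ (x + y) # vs)
          = unshuffle_sum m \<phi> ([] @ x # vs) + unshuffle_sum m \<phi> ([] @ y # vs)"
        by (cases m) (simp_all add: l_fun(1) r(1) unshuffle_sum_add signed_add_right)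
      show "unshuffle_sum m \<phi> ([] @ s1 c x # vs) = s2 c (unshuffle_sum m \<phi> ([] @ x # vs))"
        by (cases m) (simp_all add: l_fun(2) r(2) vs2.scale_right_distrib
            vs2.scale_right_diff_distrib sc vs2.scale_signed)
      show "unshuffle_sum m \<phi> ([] @ x # y # vs) = - unshuffle_sum m \<phi> ([] @ y # x # vs)"
      proof (cases m)
        case 0
        then show ?thesis by (simp add: rr)
      next
        case (Suc m')
        then show ?thesis by (cases m') (simp_all add: rr ll signed_def)
      qed
    qed
  next
    case (Cons u us)
    have p: "alternating_multilinear s1 s2 (\<lambda>ys. \<phi> (u # ys) zs)"
      "alternating_multilinear s1 s2 (\<lambda>zs. \<phi> ys (u # zs))"
      "alternating_multilinear s1 s2 (\<lambda>ys. \<phi> ys (u # zs))"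
      "alternating_multilinear s1 s2 (\<lambda>zs. \<phi> (u # ys) zs)" for ys zs
      by (rule alternating_multilinear_Cons Cons.prems
          | rule alternating_multilinear_Cons, rule Cons.prems)+
    note IH = Cons.IH[of "\<lambda>ys. \<phi> (u # ys)" "m - 1", OF p(1,4)]
      Cons.IH[of "\<lambda>ys zs. \<phi> ys (u # zs)" m, OF p(3,2)]
    show ?case
      using IH by (cases m) (simp_all add: signed_add_right vs2.scale_right_distrib
          vs2.scale_right_diff_distrib vs2.scale_signed)
  qed
  then show ?thesis unfolding alternating_multilinear_def by blast
qed

end

text \<open>
  Exchanges of neighbours bring the two equal entries together. Then the value equals its own
  negative, which is zero in characteristic \<open>0\<close>.
\<close>

lemma alternating_multilinear_repeated:
  fixes s2 :: "'k::field_char_0 \<Rightarrow> 'h::ab_group_add \<Rightarrow> 'h"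
  assumes "vector_space s2" and f: "alternating_multilinear s1 s2 f"
  shows "f (us @ a # ys @ a # vs) = 0"
proof (induction ys arbitrary: us)
  case Nil
  interpret vector_space s2 by fact
  have "f (us @ a # a # vs) = - f (us @ a # a # vs)"
    using f by (rule alternating_multilinearD(3))
  moreover have "s2 2 (f (us @ a # a # vs)) = f (us @ a # a # vs) + f (us @ a # a # vs)"
    using scale_left_distrib[of 1 1] by simp
  ultimately have "s2 2 (f (us @ a # a # vs)) = 0"
    by (simp add: eq_neg_iff_add_eq_0)
  then show ?case by simp
next
  case (Cons b ys)
  have "f (us @ a # (b # ys) @ a # vs) = - f ((us @ [b]) @ a # ys @ a # vs)"
    using alternating_multilinearD(3)[OF f, of us a b "ys @ a # vs"] by simp
  then show ?case using Cons.IH[of "us @ [b]"] by simp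
qed

lemma alternating_maps_iff:
  fixes s1 :: "'k::field_char_0 \<Rightarrow> 'g::ab_group_add \<Rightarrow> 'g" and s2 :: "'k \<Rightarrow> 'h::ab_group_add \<Rightarrow> 'h"
  assumes s1: "vector_space s1" and s2: "vector_space s2"
  shows "f \<in> alternating_maps s1 s2 n
    \<longleftrightarrow> (\<forall>xs. length xs \<noteq> n \<longrightarrow> f xs = 0) \<and> alternating_multilinear s1 s2 f"
proof -
  interpret vector_space_pair s1 s2 using s1 s2 by (simp add: vector_space_pair_def)
  show ?thesis
  proof
    assume f: "f \<in> alternating_maps s1 s2 n"
    then have short: "length xs \<noteq> n \<Longrightarrow> f xs = 0" for xs
      by (simp add: alternating_maps_def)
    have lin: "f (us @ (x + y) # vs) = f (us @ x # vs) + f (us @ y # vs)"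
      "f (us @ s1 c x # vs) = s2 c (f (us @ x # vs))" for us x y vs c
    proof -
      have "Vector_Spaces.linear s1 s2 (\<lambda>x. f (us @ x # vs))" if "length us + Suc (length vs) = n"
      proof -
        have "Vector_Spaces.linear s1 s2 (\<lambda>x. f ((us @ 0 # vs)[length us := x]))"
          using f that unfolding alternating_maps_def
          by (elim CollectE conjE allE[of _ "us @ 0 # vs"] allE[of _ "length us"]) simp
        then show ?thesis by simp
      qed
      then show "f (us @ (x + y) # vs) = f (us @ x # vs) + f (us @ y # vs)"
        "f (us @ s1 c x # vs) = s2 c (f (us @ x # vs))"
        by (cases "length us + Suc (length vs) = n"; simp add: short Vector_Spaces.linear_iff)+
    qed
    have rep: "f (us @ x # x # vs) = 0" for us x vs
    proof (cases "length (us @ x # x # vs) = n")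
      case True
      have "\<forall>xs i j. length xs = n \<and> i < j \<and> j < n \<and> xs ! i = xs ! j \<longrightarrow> f xs = 0"
        using f by (simp add: alternating_maps_def)
      from this[rule_format, of "us @ x # x # vs" "length us" "Suc (length us)"] True
      show ?thesis by (simp add: nth_append)
    qed (simp add: short)
    have "f (us @ x # y # vs) = - f (us @ y # x # vs)" for us x y vs
    proof -
      \<comment> \<open>Polarization of the vanishing on equal neighbours.\<close>
      have "0 = f (us @ (x + y) # (x + y) # vs)" using rep by simp
      also have "\<dots> = f (us @ x # (x + y) # vs) + f (us @ y # (x + y) # vs)"
        by (rule lin(1))
      also have "f (us @ x # (x + y) # vs) = f (us @ x # x # vs) + f (us @ x # y # vs)"
        using lin(1)[of "us @ [x]" x y vs] by simp
      also have "f (us @ y # (x + y) # vs) = f (us @ y # x # vs) + f (us @ y # y # vs)"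
        using lin(1)[of "us @ [y]" x y vs] by simp
      finally show ?thesis by (simp add: rep eq_neg_iff_add_eq_0)
    qed
    then show "(\<forall>xs. length xs \<noteq> n \<longrightarrow> f xs = 0) \<and> alternating_multilinear s1 s2 f"
      unfolding alternating_multilinear_def using short lin by blast
  next
    assume f: "(\<forall>xs. length xs \<noteq> n \<longrightarrow> f xs = 0) \<and> alternating_multilinear s1 s2 f"
    then have alt: "alternating_multilinear s1 s2 f" by blast
    have "Vector_Spaces.linear s1 s2 (\<lambda>x. f (xs[i := x]))" if "i < length xs" for xs i
      using alternating_multilinearD(1,2)[OF alt] that s1 s2
      by (simp add: upd_conv_take_nth_drop Vector_Spaces.linear_iff)
    moreover have "f xs = 0" if "i < j" "j < length xs" "xs ! i = xs ! j" for xs i j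
    proof -
      define ys where "ys = take (j - Suc i) (drop (Suc i) xs)"
      have "xs = take i xs @ xs ! i # drop (Suc i) xs"
        using that by (intro id_take_nth_drop) simp
      also have "drop (Suc i) xs = ys @ xs ! j # drop (Suc j) xs"
        using that id_take_nth_drop[of "j - Suc i" "drop (Suc i) xs"] unfolding ys_def by simp
      finally have "xs = take i xs @ xs ! i # ys @ xs ! i # drop (Suc j) xs"
        using that by simp
      then show ?thesis using alternating_multilinear_repeated[OF s2 alt] by metis
    qed
    ultimately show "f \<in> alternating_maps s1 s2 n"
      using f unfolding alternating_maps_def by auto
  qed
qed

section \<open>Insertion of operators into cochains\<close>

text \<open>
  The contraction \<open>i\<^sub>P F\<close> for an operator \<open>P\<close> of degree \<open>m\<close>, hence of arity \<open>m + 1\<close>. The arity of \<open>F\<close>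
  need not be given, because \<open>F\<close> vanishes on argument lists of other lengths.
\<close>

definition insertion ::
    "('g \<Rightarrow> 'g) \<Rightarrow> nat \<Rightarrow> ('g list \<Rightarrow> 'g) \<Rightarrow> ('g list \<Rightarrow> 'v::ab_group_add) \<Rightarrow> 'g list \<Rightarrow> 'v"
  where "insertion \<alpha> m P F =
    unshuffle_sum (Suc m) (\<lambda>ys zs. F (P ys # map (\<alpha> ^^ m) zs))"

text \<open>
  The part of \<open>i\<^sub>P (i\<^sub>Q F)\<close> in which neither operator is an argument of the other. The sign is
  that of moving the value of \<open>P\<close> past the \<open>n + 1\<close> arguments of \<open>Q\<close>; the power of \<open>\<alpha>\<close> outside \<open>Q\<close>
  is the one on its arguments, since \<open>Q\<close> commutes with \<open>\<alpha>\<close>.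
\<close>

definition double_insertion ::
    "('g \<Rightarrow> 'g) \<Rightarrow> nat \<Rightarrow> nat \<Rightarrow> ('g list \<Rightarrow> 'g) \<Rightarrow> ('g list \<Rightarrow> 'g) \<Rightarrow> ('g list \<Rightarrow> 'v::ab_group_add) \<Rightarrow>
     'g list \<Rightarrow> 'v"
  where "double_insertion \<alpha> m n P Q F = (\<lambda>xs. signed (Suc n)
    (unshuffle_sum (Suc m) (\<lambda>ys. unshuffle_sum (Suc n) (\<lambda>us vs.
      F ((\<alpha> ^^ m) (Q us) # (\<alpha> ^^ n) (P ys) # map (\<alpha> ^^ (m + n)) vs))) xs))"

lemma signed_fun_apply: "signed k f x = signed k (f x)"
  by (simp add: signed_def)

lemma map_funpow_map_funpow: "map (f ^^ m) (map (f ^^ n) xs) = map (f ^^ (m + n)) xs"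
  by (simp add: funpow_add)

text \<open>
  Two vector spaces with twists, the setting of cochains and insertions. With source and target equal,
  the cochains of positive degree are the operators, so each result on cochains applies to operators
  by \<open>source_modules\<close> and \<open>operators_eq\<close>.
\<close>

locale hom_modules = G: vector_space sg + H: vector_space sh
  for sg :: "'k::field_char_0 \<Rightarrow> 'g::ab_group_add \<Rightarrow> 'g" and sh :: "'k \<Rightarrow> 'h::ab_group_add \<Rightarrow> 'h" +
  fixes \<alpha> :: "'g \<Rightarrow> 'g" and \<beta> :: "'h \<Rightarrow> 'h"
  assumes linear_\<alpha>: "Vector_Spaces.linear sg sg \<alpha>" and linear_\<beta>: "Vector_Spaces.linear sh sh \<beta>"
begin

sublocale GH: vector_space_pair sg sh
  by unfold_locales

lemma source_modules: "hom_modules sg sg \<alpha> \<alpha>"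
  by (simp add: hom_modules_def hom_modules_axioms_def G.vector_space_axioms linear_\<alpha>)

abbreviation "operators \<equiv> C_gg sg \<alpha>"
abbreviation "cochains \<equiv> C_gh sg \<alpha> sh \<beta>"

lemma additive_\<beta>_power: "additive (\<beta> ^^ k)"
  using linear_funpow[OF linear_\<beta>] by (simp add: additive_def Vector_Spaces.linear_iff)

lemma \<beta>_zero [simp]: "\<beta> 0 = 0"
  using additive.zero[OF additive_\<beta>_power[of 1]] by simp

lemma \<beta>_power_zero [simp]: "(\<beta> ^^ k) 0 = 0"
  using additive.zero[OF additive_\<beta>_power] .

text \<open>
  A description that is uniform in the degree: in degree \<open>0\<close> the only cochain is zero, and it satisfies
  all the other conditions. Compatibility with the twists may be demanded on lists of every length, since
  elsewhere both sides vanish.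
\<close>

lemma cochains_iff:
  "F \<in> cochains n \<longleftrightarrow> (n = 0 \<longrightarrow> F = 0) \<and> (\<forall>xs. length xs \<noteq> n \<longrightarrow> F xs = 0) \<and>
    alternating_multilinear sg sh F \<and> (\<forall>xs. \<beta> (F xs) = F (map \<alpha> xs))"
proof (cases "n = 0")
  case True
  then show ?thesis by (auto simp: C_gh_def alternating_multilinear_def)
next
  case False
  have "(\<forall>xs. length xs \<noteq> n \<longrightarrow> F xs = 0) \<Longrightarrow>
    (\<forall>xs. length xs = n \<longrightarrow> \<beta> (F xs) = F (map \<alpha> xs)) \<longleftrightarrow> (\<forall>xs. \<beta> (F xs) = F (map \<alpha> xs))"
    by (metis \<beta>_zero length_map)
  with False show ?thesis
    by (auto simp: C_gh_def hom_cochains_def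
        alternating_maps_iff[OF G.vector_space_axioms H.vector_space_axioms])
qed

lemma cochainsD:
  assumes "F \<in> cochains n"
  shows "length xs \<noteq> n \<Longrightarrow> F xs = 0" "alternating_multilinear sg sh F"
    "\<beta> (F xs) = F (map \<alpha> xs)" "n = 0 \<Longrightarrow> F = 0"
  using assms unfolding cochains_iff by blast+

lemma \<beta>_power_cochain:
  assumes "F \<in> cochains n"
  shows "(\<beta> ^^ k) (F xs) = F (map (\<alpha> ^^ k) xs)"
  by (induction k) (simp_all add: cochainsD(3)[OF assms] o_def)

lemma operators_eq: "operators m = C_gh sg \<alpha> sg \<alpha> (Suc m)"
  by (simp add: C_gg_def C_gh_def)

lemma operatorsD:
  assumes "P \<in> operators m"
  shows "length xs \<noteq> Suc m \<Longrightarrow> P xs = 0" "alternating_multilinear sg sg P"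
    "\<alpha> (P xs) = P (map \<alpha> xs)" "(\<alpha> ^^ k) (P xs) = P (map (\<alpha> ^^ k) xs)"
proof -
  interpret S: hom_modules sg sg \<alpha> \<alpha> by (rule source_modules)
  note P = assms[unfolded operators_eq]
  show "length xs \<noteq> Suc m \<Longrightarrow> P xs = 0" "alternating_multilinear sg sg P"
    "\<alpha> (P xs) = P (map \<alpha> xs)" "(\<alpha> ^^ k) (P xs) = P (map (\<alpha> ^^ k) xs)"
    using S.cochainsD(1-3)[OF P] S.\<beta>_power_cochain[OF P] by blast+
qed

lemma additive_first_argument:
  assumes "F \<in> cochains n"
  shows "additive (\<lambda>x. F (x # xs))"
  using alternating_multilinearD_hd(1)[OF cochainsD(2)[OF assms]] by (simp add: additive_def)

lemma linear_first_argument: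
  assumes "F \<in> cochains n"
  shows "Vector_Spaces.linear sg sh (\<lambda>x. F (x # xs))"
  using alternating_multilinearD_hd(1,2)[OF cochainsD(2)[OF assms]]
  by (simp add: Vector_Spaces.linear_iff G.vector_space_axioms H.vector_space_axioms)

lemma insertion_closed:
  assumes P: "P \<in> operators m" and F: "F \<in> cochains n"
  shows "insertion \<alpha> m P F \<in> cochains (m + n)"
  unfolding cochains_iff
proof (intro conjI impI allI)
  show "insertion \<alpha> m P F = 0" if "m + n = 0"
    using that cochainsD(4)[OF F] by (auto simp: insertion_def fun_eq_iff)
  show "insertion \<alpha> m P F xs = 0" if "length xs \<noteq> m + n" for xs
    unfolding insertion_def using that
    by (intro unshuffle_sum_eq_0 cochainsD(1)[OF F]) auto
  show "alternating_multilinear sg sh (insertion \<alpha> m P F)"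
    unfolding insertion_def
  proof (rule GH.alternating_multilinear_unshuffle_sum)
    show "alternating_multilinear sg sh (\<lambda>ys. F (P ys # map (\<alpha> ^^ m) zs))" for zs
      using operatorsD(2)[OF P] linear_first_argument[OF F] by (rule alternating_multilinear_linear)
    show "alternating_multilinear sg sh (\<lambda>zs. F (P ys # map (\<alpha> ^^ m) zs))" for ys
      by (rule alternating_multilinear_map[OF alternating_multilinear_Cons linear_funpow])
        (rule cochainsD(2)[OF F] linear_\<alpha>)+
  qed
  have "map (\<alpha> ^^ m) (map \<alpha> zs) = map \<alpha> (map (\<alpha> ^^ m) zs)" for zs
    by (simp add: funpow_swap1)
  then show "\<beta> (insertion \<alpha> m P F xs) = insertion \<alpha> m P F (map \<alpha> xs)" for xs
    unfolding insertion_def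
    by (subst additive_unshuffle_sum[OF additive_\<beta>_power[of 1, simplified]])
      (simp only: unshuffle_sum_map cochainsD(3)[OF F] operatorsD(3)[OF P] list.map)
qed

lemma insertion_add_left:
  assumes "F \<in> cochains n"
  shows "insertion \<alpha> m (P + P') F = insertion \<alpha> m P F + insertion \<alpha> m P' F"
  by (simp add: fun_eq_iff insertion_def additive.add[OF additive_first_argument[OF assms]]
      unshuffle_sum_add)

lemma insertion_scale_left:
  assumes "F \<in> cochains n"
  shows "insertion \<alpha> m (fun_scale sg c P) F = fun_scale sh c (insertion \<alpha> m P F)"
  by (simp add: fun_eq_iff insertion_def fun_scale_def
      alternating_multilinearD_hd(2)[OF cochainsD(2)[OF assms]]
      additive_unshuffle_sum[of "sh c"] additive_def H.scale_right_distrib)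

lemma insertion_scale_right: "insertion \<alpha> m P (fun_scale sh c F) = fun_scale sh c (insertion \<alpha> m P F)"
  by (simp add: fun_eq_iff insertion_def fun_scale_def
      additive_unshuffle_sum[of "sh c"] additive_def H.scale_right_distrib)

text \<open>
  The head of the argument list that \<open>i\<^sub>P\<close> passes to \<open>i\<^sub>Q F\<close> is the value of \<open>P\<close>. If it becomes an
  argument of \<open>Q\<close>, coassociativity joins the arguments of \<open>P\<close> with the other ones of \<open>Q\<close> and gives the
  first summand. Otherwise it becomes an argument of \<open>F\<close> next to \<open>Q\<close>.
\<close>

lemma insertion_insertion:
  assumes P: "P \<in> operators m" and Q: "Q \<in> operators n" and F: "F \<in> cochains k"
  shows "insertion \<alpha> m P (insertion \<alpha> n Q F)
    = insertion \<alpha> (m + n) (insertion \<alpha> m P Q) F + double_insertion \<alpha> m n P Q F"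
proof
  fix xs
  have "insertion \<alpha> n Q F (P ys # map (\<alpha> ^^ m) zs)
      = unshuffle_sum n (\<lambda>us vs. F (Q (P ys # map (\<alpha> ^^ m) us) # map (\<alpha> ^^ (m + n)) vs)) zs
      + signed (Suc n) (unshuffle_sum (Suc n)
          (\<lambda>us vs. F ((\<alpha> ^^ m) (Q us) # (\<alpha> ^^ n) (P ys) # map (\<alpha> ^^ (m + n)) vs)) zs)" for ys zs
    unfolding insertion_def unshuffle_sum.simps unshuffle_sum_map list.map(2)
      map_funpow_map_funpow operatorsD(4)[OF Q] by (simp only: add.commute)
  then have "insertion \<alpha> m P (insertion \<alpha> n Q F) xs
      = unshuffle_sum (Suc m) (\<lambda>ys. unshuffle_sum n
          (\<lambda>us vs. F (Q (P ys # map (\<alpha> ^^ m) us) # map (\<alpha> ^^ (m + n)) vs))) xs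
      + double_insertion \<alpha> m n P Q F xs"
    unfolding double_insertion_def insertion_def[of \<alpha> m] signed_unshuffle_sum
    by (simp only: unshuffle_sum_add)
  also have "unshuffle_sum (Suc m) (\<lambda>ys. unshuffle_sum n
          (\<lambda>us vs. F (Q (P ys # map (\<alpha> ^^ m) us) # map (\<alpha> ^^ (m + n)) vs))) xs
      = insertion \<alpha> (m + n) (insertion \<alpha> m P Q) F xs"
    unfolding insertion_def additive_unshuffle_sum[OF additive_first_argument[OF F]]
      unshuffle_sum_coassoc[symmetric] by simp
  finally show "insertion \<alpha> m P (insertion \<alpha> n Q F) xs
    = (insertion \<alpha> (m + n) (insertion \<alpha> m P Q) F + double_insertion \<alpha> m n P Q F) xs"
    by simp
qed

text \<open>
  Exchanging the blocks of arguments of \<open>P\<close> and \<open>Q\<close> gives the sign \<open>(-1)\<close> to the power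
  \<open>(m + 1) * (n + 1)\<close>, exchanging the two values inside \<open>F\<close> a further sign; together with the signs in
  the definition this is \<open>(-1)\<close> to the power \<open>m * n\<close>.
\<close>

lemma double_insertion_commute:
  assumes F: "F \<in> cochains k"
  shows "double_insertion \<alpha> m n P Q F = signed (m * n) (double_insertion \<alpha> n m Q P F)"
proof
  fix xs
  have swap: "F ((\<alpha> ^^ m) (Q us) # (\<alpha> ^^ n) (P ys) # map (\<alpha> ^^ (m + n)) vs)
      = - F ((\<alpha> ^^ n) (P ys) # (\<alpha> ^^ m) (Q us) # map (\<alpha> ^^ (n + m)) vs)" for us ys vs
    unfolding add.commute[of n m] by (rule alternating_multilinearD_hd(3)[OF cochainsD(2)[OF F]])
  show "double_insertion \<alpha> m n P Q F xs = signed (m * n) (double_insertion \<alpha> n m Q P F) xs"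
    unfolding signed_fun_apply double_insertion_def
    by (subst unshuffle_sum_exchange)
      (simp only: swap unshuffle_sum_uminus, simp add: signed_def)
qed

end

section \<open>The cup product bracket\<close>

text \<open>
  The cup product bracket of cochains of degrees \<open>m\<close> and \<open>n\<close>. For \<open>m = 0\<close> or \<open>n = 0\<close> one
  exponent is truncated, but then one of the cochains is zero.
\<close>

definition cup ::
    "('h \<Rightarrow> 'h \<Rightarrow> 'h) \<Rightarrow> ('h \<Rightarrow> 'h) \<Rightarrow> nat \<Rightarrow> nat \<Rightarrow> ('g list \<Rightarrow> 'h) \<Rightarrow> ('g list \<Rightarrow> 'h) \<Rightarrow>
     'g list \<Rightarrow> 'h::ab_group_add"
  where "cup br \<beta> m n E F =
    unshuffle_sum m (\<lambda>ys zs. br ((\<beta> ^^ (n - 1)) (E ys)) ((\<beta> ^^ (m - 1)) (F zs)))"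

locale hom_lie_module = hom_modules sg sh \<alpha> \<beta> + hom_lie_algebra sh br \<beta>
  for sg :: "'k::field_char_0 \<Rightarrow> 'g::ab_group_add \<Rightarrow> 'g" and sh :: "'k \<Rightarrow> 'h::ab_group_add \<Rightarrow> 'h"
    and \<alpha> :: "'g \<Rightarrow> 'g" and \<beta> :: "'h \<Rightarrow> 'h" and br :: "'h \<Rightarrow> 'h \<Rightarrow> 'h"
begin

lemma br_simps:
  "br (x + y) z = br x z + br y z" "br x (y + z) = br x y + br x z"
  "br (sh c x) y = sh c (br x y)" "br x (sh c y) = sh c (br x y)"
  "br 0 y = 0" "br x 0 = 0"
proof -
  show *: "br (x + y) z = br x z + br y z" "br x (y + z) = br x y + br x z"
    "br (sh c x) y = sh c (br x y)" "br x (sh c y) = sh c (br x y)" for x y z c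
    using linear_left linear_right by (simp_all add: Vector_Spaces.linear_iff)
  show "br 0 y = 0" "br x 0 = 0" using *(1)[of 0 0 y] *(2)[of x 0 0] by simp_all
qed

lemma br_minus: "br x (- y) = - br x y"
  using br_simps(2)[of x y "- y"] by (simp add: br_simps(6) eq_neg_iff_add_eq_0 add.commute)

lemma \<beta>_power_br: "(\<beta> ^^ k) (br x y) = br ((\<beta> ^^ k) x) ((\<beta> ^^ k) y)"
  by (induction k) (simp_all add: multiplicative)

lemma \<beta>_power_linear:
  "(\<beta> ^^ k) (x + y) = (\<beta> ^^ k) x + (\<beta> ^^ k) y" "(\<beta> ^^ k) (sh c x) = sh c ((\<beta> ^^ k) x)"
  using linear_funpow[OF linear_\<beta>] by (simp_all add: Vector_Spaces.linear_iff)

lemma \<beta>_power_\<beta>_power: "(\<beta> ^^ k) ((\<beta> ^^ l) x) = (\<beta> ^^ (k + l)) x"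
  by (simp add: funpow_add)

lemma br_additive: "additive (\<lambda>x. br ((\<beta> ^^ i) x) y)" "additive (\<lambda>x. br y ((\<beta> ^^ i) x))"
  by (simp_all add: additive_def \<beta>_power_linear br_simps)

text \<open>
  The Hom-Jacobi identity in the form of a derivation rule; in this shape it matches the graded Jacobi
  identity term by term.
\<close>

lemma hom_leibniz: "br (\<beta> x) (br y z) = br (br x y) (\<beta> z) + br (\<beta> y) (br x z)"
proof -
  have "br (\<beta> x) (br y z) = - br (\<beta> z) (br x y) + - br (\<beta> y) (br z x)"
    by (metis (no_types) add.assoc eq_neg_iff_add_eq_0 hom_jacobi minus_add)
  also have "- br (\<beta> z) (br x y) = br (br x y) (\<beta> z)" using skew[of "br x y" "\<beta> z"] by simp
  also have "- br (\<beta> y) (br z x) = br (\<beta> y) (br x z)"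
    using br_minus[of "\<beta> y" "br x z"] skew[of z x] by simp
  finally show ?thesis .
qed

lemma cup_closed:
  assumes E: "E \<in> cochains m" and F: "F \<in> cochains n"
  shows "cup br \<beta> m n E F \<in> cochains (m + n)"
  unfolding cochains_iff
proof (intro conjI impI allI)
  show "cup br \<beta> m n E F = 0" if "m + n = 0"
    using that cochainsD(4)[OF F] by (auto simp: cup_def fun_eq_iff br_simps)
  show "cup br \<beta> m n E F xs = 0" if "length xs \<noteq> m + n" for xs
    unfolding cup_def using that
    by (intro unshuffle_sum_eq_0) (simp add: cochainsD(1)[OF F] br_simps)
  show "alternating_multilinear sg sh (cup br \<beta> m n E F)"
    unfolding cup_def
  proof (rule GH.alternating_multilinear_unshuffle_sum)
    show "alternating_multilinear sg sh (\<lambda>ys. br ((\<beta> ^^ (n - 1)) (E ys)) ((\<beta> ^^ (m - 1)) (F zs)))" for zs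
      by (rule alternating_multilinear_linear[OF cochainsD(2)[OF E]])
        (simp add: Vector_Spaces.linear_iff H.vector_space_axioms br_simps \<beta>_power_linear)
    show "alternating_multilinear sg sh (\<lambda>zs. br ((\<beta> ^^ (n - 1)) (E ys)) ((\<beta> ^^ (m - 1)) (F zs)))" for ys
      by (rule alternating_multilinear_linear[OF cochainsD(2)[OF F]])
        (simp add: Vector_Spaces.linear_iff H.vector_space_axioms br_simps \<beta>_power_linear)
  qed
  show "\<beta> (cup br \<beta> m n E F xs) = cup br \<beta> m n E F (map \<alpha> xs)" for xs
    unfolding cup_def
    by (subst additive_unshuffle_sum[OF additive_\<beta>_power[of 1, simplified]])
      (simp only: unshuffle_sum_map multiplicative funpow_swap1 cochainsD(3)[OF F] cochainsD(3)[OF E])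
qed

lemma cup_add_left: "cup br \<beta> m n (E + E') F = cup br \<beta> m n E F + cup br \<beta> m n E' F"
  and cup_add_right: "cup br \<beta> m n E (F + F') = cup br \<beta> m n E F + cup br \<beta> m n E F'"
  by (simp_all add: fun_eq_iff cup_def \<beta>_power_linear br_simps unshuffle_sum_add)

lemma cup_scale_left: "cup br \<beta> m n (fun_scale sh c E) F = fun_scale sh c (cup br \<beta> m n E F)"
  and cup_scale_right: "cup br \<beta> m n E (fun_scale sh c F) = fun_scale sh c (cup br \<beta> m n E F)"
  by (simp_all add: fun_eq_iff cup_def fun_scale_def \<beta>_power_linear br_simps
      additive_unshuffle_sum[of "sh c"] additive_def H.scale_right_distrib)

text \<open>
  Cocommutativity contributes the graded sign, skew-symmetry of the bracket of the target the other
  one. Cocommutativity needs the right number of arguments; elsewhere both sides vanish.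
\<close>

lemma cup_skew:
  assumes E: "E \<in> cochains m" and F: "F \<in> cochains n"
  shows "cup br \<beta> m n E F = - signed (m * n) (cup br \<beta> n m F E)"
proof
  fix xs
  show "cup br \<beta> m n E F xs = (- signed (m * n) (cup br \<beta> n m F E)) xs"
  proof (cases "length xs = m + n")
    case True
    have "br ((\<beta> ^^ (n - 1)) (E ys)) ((\<beta> ^^ (m - 1)) (F zs))
        = - br ((\<beta> ^^ (m - 1)) (F zs)) ((\<beta> ^^ (n - 1)) (E ys))" for ys zs
      by (rule skew)
    then show ?thesis
      unfolding fun_Compl_def signed_fun_apply cup_def unshuffle_sum_commute[OF True]
      by (simp only: unshuffle_sum_uminus signed_simps)
  next
    case False
    then show ?thesis
      using cochainsD(1)[OF cup_closed[OF E F]] cochainsD(1)[OF cup_closed[OF F E]]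
      by (simp add: signed_fun_apply add.commute)
  qed
qed

text \<open>
  The operator \<open>i\<^sub>P\<close> is a derivation of degree \<open>m\<close>: the value of \<open>P\<close> becomes an argument of \<open>E\<close> or of \<open>F\<close>.
  In the second case it passes the \<open>e\<close> arguments of \<open>E\<close>, and the block of \<open>m + 1\<close> arguments of \<open>P\<close> then
  passes them back, so that the sign \<open>(-1)\<close> to the power \<open>m * e\<close> remains. The powers of \<open>\<alpha>\<close> on the
  remaining arguments turn into powers of \<open>\<beta>\<close> on the values of the cochains.
\<close>

lemma insertion_cup:
  assumes P: "P \<in> operators m" and E: "E \<in> cochains e" and F: "F \<in> cochains f"
  shows "insertion \<alpha> m P (cup br \<beta> e f E F)
    = cup br \<beta> (m + e) f (insertion \<alpha> m P E) F + signed (m * e) (cup br \<beta> e (m + f) E (insertion \<alpha> m P F))"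
proof (cases "e = 0 \<or> f = 0")
  case True
  then have "E = 0 \<or> F = 0" using cochainsD(4) E F by blast
  then show ?thesis by (auto simp: fun_eq_iff insertion_def cup_def br_simps signed_fun_apply)
next
  case False
  then obtain e' f' where e: "e = Suc e'" and f: "f = Suc f'"
    by (metis not0_implies_Suc)
  show ?thesis
  proof
    fix xs
    have "cup br \<beta> e f E F (P ys # map (\<alpha> ^^ m) zs)
        = unshuffle_sum e' (\<lambda>us vs. br ((\<beta> ^^ f') (E (P ys # map (\<alpha> ^^ m) us))) ((\<beta> ^^ (m + e')) (F vs))) zs
        + signed e (unshuffle_sum e (\<lambda>us vs.
            br ((\<beta> ^^ (m + f')) (E us)) ((\<beta> ^^ e') (F (P ys # map (\<alpha> ^^ m) vs)))) zs)" for ys zs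
      unfolding cup_def e unshuffle_sum.simps unshuffle_sum_map list.map(2)
      by (simp add: f \<beta>_power_cochain[OF E] \<beta>_power_cochain[OF F] map_funpow_map_funpow add.commute
          del: map_map)
    then have "insertion \<alpha> m P (cup br \<beta> e f E F) xs
        = unshuffle_sum (Suc m) (\<lambda>ys. unshuffle_sum e'
            (\<lambda>us vs. br ((\<beta> ^^ f') (E (P ys # map (\<alpha> ^^ m) us))) ((\<beta> ^^ (m + e')) (F vs)))) xs
        + signed e (unshuffle_sum (Suc m) (\<lambda>ys. unshuffle_sum e
            (\<lambda>us vs. br ((\<beta> ^^ (m + f')) (E us)) ((\<beta> ^^ e') (F (P ys # map (\<alpha> ^^ m) vs))))) xs)"
      unfolding insertion_def signed_unshuffle_sum by (simp only: unshuffle_sum_add)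
    also have "unshuffle_sum (Suc m) (\<lambda>ys. unshuffle_sum e'
            (\<lambda>us vs. br ((\<beta> ^^ f') (E (P ys # map (\<alpha> ^^ m) us))) ((\<beta> ^^ (m + e')) (F vs)))) xs
        = cup br \<beta> (m + e) f (insertion \<alpha> m P E) F xs"
      unfolding unshuffle_sum_coassoc[symmetric] cup_def insertion_def additive_unshuffle_sum[OF br_additive(1)]
      by (simp add: e f)
    also have "unshuffle_sum (Suc m) (\<lambda>ys. unshuffle_sum e
            (\<lambda>us vs. br ((\<beta> ^^ (m + f')) (E us)) ((\<beta> ^^ e') (F (P ys # map (\<alpha> ^^ m) vs))))) xs
        = signed (Suc m * e) (cup br \<beta> e (m + f) E (insertion \<alpha> m P F) xs)"
      unfolding cup_def insertion_def additive_unshuffle_sum[OF br_additive(2)] unshuffle_sum_exchange[of "Suc m"]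
      by (simp add: e f)
    also have "signed e (signed (Suc m * e) v) = signed (m * e) v" for v :: 'h
      by (simp add: signed_def)
    finally show "insertion \<alpha> m P (cup br \<beta> e f E F) xs = (cup br \<beta> (m + e) f (insertion \<alpha> m P E) F
        + signed (m * e) (cup br \<beta> e (m + f) E (insertion \<alpha> m P F))) xs"
      by (simp add: signed_fun_apply)
  qed
qed

text \<open>
  Let all degrees be positive; otherwise every term vanishes. With the blocks of arguments brought into
  the same order, each of the three terms is a sum of iterated brackets of values of
  \<open>\<beta>\<^bsup>n+k-2\<^esup> E\<close>, \<open>\<beta>\<^bsup>m+k-2\<^esup> F\<close> and \<open>\<beta>\<^bsup>m+n-2\<^esup> K\<close>, and the identity holds for each summand by \<open>hom_leibniz\<close>.
\<close>

lemma cup_jacobi: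
  assumes E: "E \<in> cochains m" and F: "F \<in> cochains n" and K: "K \<in> cochains k"
  shows "cup br \<beta> m (n + k) E (cup br \<beta> n k F K)
    = cup br \<beta> (m + n) k (cup br \<beta> m n E F) K + signed (m * n) (cup br \<beta> n (m + k) F (cup br \<beta> m k E K))"
proof (cases "m = 0 \<or> n = 0 \<or> k = 0")
  case True
  then have "E = 0 \<or> F = 0 \<or> K = 0" using cochainsD(4) E F K by blast
  then show ?thesis by (auto simp: fun_eq_iff cup_def br_simps signed_fun_apply)
next
  case False
  then obtain m' n' k' where m: "m = Suc m'" and n: "n = Suc n'" and k: "k = Suc k'"
    by (metis not0_implies_Suc)
  show ?thesis
  proof
    fix xs
    let ?E = "\<lambda>xs. (\<beta> ^^ (n' + k')) (E xs)" and ?F = "\<lambda>xs. (\<beta> ^^ (m' + k')) (F xs)"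
      and ?K = "\<lambda>xs. (\<beta> ^^ (m' + n')) (K xs)"
    have 1: "cup br \<beta> m (n + k) E (cup br \<beta> n k F K) xs
        = unshuffle_sum m (\<lambda>as. unshuffle_sum n (\<lambda>bs cs. br (\<beta> (?E as)) (br (?F bs) (?K cs)))) xs"
      unfolding cup_def additive_unshuffle_sum[OF br_additive(2)]
      by (simp add: m n k \<beta>_power_br \<beta>_power_\<beta>_power)
    have 2: "cup br \<beta> (m + n) k (cup br \<beta> m n E F) K xs
        = unshuffle_sum m (\<lambda>as. unshuffle_sum n (\<lambda>bs cs. br (br (?E as) (?F bs)) (\<beta> (?K cs)))) xs"
      unfolding cup_def additive_unshuffle_sum[OF br_additive(1)] unshuffle_sum_coassoc
      by (simp add: m n k \<beta>_power_br \<beta>_power_\<beta>_power add.commute)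
    have 3: "signed (m * n) (cup br \<beta> n (m + k) F (cup br \<beta> m k E K) xs)
        = unshuffle_sum m (\<lambda>as. unshuffle_sum n (\<lambda>bs cs. br (\<beta> (?F bs)) (br (?E as) (?K cs)))) xs"
      unfolding cup_def additive_unshuffle_sum[OF br_additive(2)] unshuffle_sum_exchange[of m]
      by (simp add: m n k \<beta>_power_br \<beta>_power_\<beta>_power add.commute)
    have leibniz: "br (\<beta> (?E as)) (br (?F bs) (?K cs))
        = br (br (?E as) (?F bs)) (\<beta> (?K cs)) + br (\<beta> (?F bs)) (br (?E as) (?K cs))" for as bs cs
      by (rule hom_leibniz)
    show "cup br \<beta> m (n + k) E (cup br \<beta> n k F K) xs = (cup br \<beta> (m + n) k (cup br \<beta> m n E F) K
        + signed (m * n) (cup br \<beta> n (m + k) F (cup br \<beta> m k E K))) xs"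
      unfolding plus_fun_apply signed_fun_apply 1 2 3 by (simp only: leibniz unshuffle_sum_add)
  qed
qed

end

section \<open>Graded Lie algebras from homogeneous brackets\<close>

text \<open>
  Brackets between homogeneous components that satisfy the graded axioms, together with projections that
  are linear on the whole ambient space. Everything that concerns the extension to inhomogeneous elements
  is settled here once for both algebras.
\<close>

locale graded_bracket = vector_space scale
  for scale :: "'k::field_char_0 \<Rightarrow> 'v::ab_group_add \<Rightarrow> 'v" +
  fixes V :: "nat \<Rightarrow> 'v set" and \<pi> :: "nat \<Rightarrow> 'v \<Rightarrow> 'v" and B :: "nat \<Rightarrow> nat \<Rightarrow> 'v \<Rightarrow> 'v \<Rightarrow> 'v"
  assumes subspace_component: "subspace (V n)"
    and proj_add: "\<pi> n (x + y) = \<pi> n x + \<pi> n y"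
    and proj_scale: "\<pi> n (scale c x) = scale c (\<pi> n x)"
    and proj_same: "x \<in> V n \<Longrightarrow> \<pi> n x = x"
    and proj_other: "x \<in> V n \<Longrightarrow> m \<noteq> n \<Longrightarrow> \<pi> m x = 0"
    and B_add_left: "\<lbrakk>x \<in> V m; x' \<in> V m; y \<in> V n\<rbrakk> \<Longrightarrow> B m n (x + x') y = B m n x y + B m n x' y"
    and B_add_right: "\<lbrakk>x \<in> V m; y \<in> V n; y' \<in> V n\<rbrakk> \<Longrightarrow> B m n x (y + y') = B m n x y + B m n x y'"
    and B_scale_left: "\<lbrakk>x \<in> V m; y \<in> V n\<rbrakk> \<Longrightarrow> B m n (scale c x) y = scale c (B m n x y)"
    and B_scale_right: "\<lbrakk>x \<in> V m; y \<in> V n\<rbrakk> \<Longrightarrow> B m n x (scale c y) = scale c (B m n x y)"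
    and B_closed: "\<lbrakk>x \<in> V m; y \<in> V n\<rbrakk> \<Longrightarrow> B m n x y \<in> V (m + n)"
    and B_skew: "\<lbrakk>x \<in> V m; y \<in> V n\<rbrakk> \<Longrightarrow> B m n x y = - signed (m * n) (B n m y x)"
    and B_jacobi: "\<lbrakk>x \<in> V m; y \<in> V n; z \<in> V p\<rbrakk> \<Longrightarrow>
        B m (n + p) x (B n p y z) = B (m + n) p (B m n x y) z + signed (m * n) (B n (m + p) y (B m p x z))"
begin

lemma proj_zero: "\<pi> n 0 = 0"
  using proj_add[of n 0 0] by simp

text \<open>
  Elements with homogeneous components, finitely many of them nonzero, form a subspace that contains all
  \<open>V n\<close>, hence the span.
\<close>

lemma proj_total:
  assumes "x \<in> total_space scale V"
  shows "\<pi> m x \<in> V m" and "finite {m. \<pi> m x \<noteq> 0}"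
proof -
  let ?T = "{x. (\<forall>m. \<pi> m x \<in> V m) \<and> finite {m. \<pi> m x \<noteq> 0}}"
  have "subspace ?T"
  proof (rule subspaceI)
    show "0 \<in> ?T" using subspace_0[OF subspace_component] by (simp add: proj_zero)
  next
    fix x y assume "x \<in> ?T" "y \<in> ?T"
    moreover have "{m. \<pi> m (x + y) \<noteq> 0} \<subseteq> {m. \<pi> m x \<noteq> 0} \<union> {m. \<pi> m y \<noteq> 0}"
      by (auto simp: proj_add)
    ultimately show "x + y \<in> ?T"
      using subspace_add[OF subspace_component] by (auto simp: proj_add elim: finite_subset)
  next
    fix c x assume "x \<in> ?T"
    moreover have "{m. \<pi> m (scale c x) \<noteq> 0} \<subseteq> {m. \<pi> m x \<noteq> 0}"
      by (auto simp: proj_scale)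
    ultimately show "scale c x \<in> ?T"
      using subspace_scale[OF subspace_component] by (auto simp: proj_scale elim: finite_subset)
  qed
  moreover have "V n \<subseteq> ?T" for n
  proof
    fix x assume x: "x \<in> V n"
    have "{m. \<pi> m x \<noteq> 0} \<subseteq> {n}" using proj_other[OF x] by auto
    moreover have "\<pi> m x \<in> V m" for m
      using x proj_same[OF x] proj_other[OF x, of m] subspace_0[OF subspace_component]
      by (cases "m = n") auto
    ultimately show "x \<in> ?T" by (auto elim: finite_subset)
  qed
  ultimately have "total_space scale V \<subseteq> ?T"
    unfolding total_space_def by (intro span_minimal) auto
  then show "\<pi> m x \<in> V m" "finite {m. \<pi> m x \<noteq> 0}" using assms by auto
qed

lemma component_subset_total: "x \<in> V n \<Longrightarrow> x \<in> total_space scale V"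
  unfolding total_space_def by (intro span_base) auto

lemma B_zero: "y \<in> V n \<Longrightarrow> B m n 0 y = 0" "x \<in> V m \<Longrightarrow> B m n x 0 = 0"
  using B_add_left[of 0 m 0 y n] B_add_right[of x m 0 n 0] subspace_0[OF subspace_component] by auto

text \<open>
  The supports in the definition of the extension depend on the arguments; a common finite set of degrees
  is what makes bilinearity visible.
\<close>

lemma bilinear_extension_eq:
  assumes x: "x \<in> total_space scale V" and y: "y \<in> total_space scale V"
    and "finite S" "finite T" "{m. \<pi> m x \<noteq> 0} \<subseteq> S" "{n. \<pi> n y \<noteq> 0} \<subseteq> T"
  shows "bilinear_extension \<pi> B x y = (\<Sum>m\<in>S. \<Sum>n\<in>T. B m n (\<pi> m x) (\<pi> n y))"
proof -
  have "(\<Sum>n\<in>T. B m n (\<pi> m x) (\<pi> n y)) = (\<Sum>n | \<pi> n y \<noteq> 0. B m n (\<pi> m x) (\<pi> n y))" for m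
    using assms proj_total(1)[OF x] by (intro sum.mono_neutral_right) (auto simp: B_zero)
  moreover have "(\<Sum>m\<in>S. \<Sum>n | \<pi> n y \<noteq> 0. B m n (\<pi> m x) (\<pi> n y))
      = (\<Sum>m | \<pi> m x \<noteq> 0. \<Sum>n | \<pi> n y \<noteq> 0. B m n (\<pi> m x) (\<pi> n y))"
    using assms proj_total(1)[OF y] by (intro sum.mono_neutral_right) (auto simp: B_zero)
  ultimately show ?thesis by (simp add: bilinear_extension_def)
qed

lemma bilinear_extension_homogeneous:
  assumes "x \<in> V m" and "y \<in> V n"
  shows "bilinear_extension \<pi> B x y = B m n x y"
proof -
  have "bilinear_extension \<pi> B x y = (\<Sum>i\<in>{m}. \<Sum>j\<in>{n}. B i j (\<pi> i x) (\<pi> j y))"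
    using assms proj_other by (intro bilinear_extension_eq) (auto intro: component_subset_total)
  then show ?thesis using assms by (simp add: proj_same)
qed

lemma total_add: "x \<in> total_space scale V \<Longrightarrow> y \<in> total_space scale V \<Longrightarrow> x + y \<in> total_space scale V"
  and total_scale: "x \<in> total_space scale V \<Longrightarrow> scale c x \<in> total_space scale V"
  by (simp_all add: total_space_def span_add span_scale)

sublocale graded_lie_algebra scale V "bilinear_extension \<pi> B"
proof
  let ?supp = "\<lambda>x. {m. \<pi> m x \<noteq> 0}"
  fix x x' y y' :: 'v and c :: 'k
  assume x: "x \<in> total_space scale V" and y: "y \<in> total_space scale V"
  note px = proj_total[OF x] and py = proj_total[OF y]
  { assume x': "x' \<in> total_space scale V"
    note px' = proj_total[OF x']
    define S where "S = ?supp x \<union> ?supp x'"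
    have "finite S" "?supp x \<subseteq> S" "?supp x' \<subseteq> S" "?supp (x + x') \<subseteq> S"
      using px px' by (auto simp: S_def proj_add)
    then show "bilinear_extension \<pi> B (x + x') y
        = bilinear_extension \<pi> B x y + bilinear_extension \<pi> B x' y"
      using py px(1) px'(1) total_add[OF x x']
      by (simp add: bilinear_extension_eq[OF _ y, where S = S and T = "?supp y"] x x'
          proj_add B_add_left sum.distrib) }
  { assume y': "y' \<in> total_space scale V"
    note py' = proj_total[OF y']
    define T where "T = ?supp y \<union> ?supp y'"
    have "finite T" "?supp y \<subseteq> T" "?supp y' \<subseteq> T" "?supp (y + y') \<subseteq> T"
      using py py' by (auto simp: T_def proj_add)
    then show "bilinear_extension \<pi> B x (y + y')
        = bilinear_extension \<pi> B x y + bilinear_extension \<pi> B x y'"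
      using px py(1) py'(1) total_add[OF y y']
      by (simp add: bilinear_extension_eq[OF x, where S = "?supp x" and T = T] y y'
          proj_add B_add_right sum.distrib) }
  have "?supp (scale c x) \<subseteq> ?supp x" "?supp (scale c y) \<subseteq> ?supp y"
    by (auto simp: proj_scale)
  then show "bilinear_extension \<pi> B (scale c x) y = scale c (bilinear_extension \<pi> B x y)"
    and "bilinear_extension \<pi> B x (scale c y) = scale c (bilinear_extension \<pi> B x y)"
    using px py
    by (simp_all add: bilinear_extension_eq[where S = "?supp x" and T = "?supp y"] x y total_scale
        proj_scale B_scale_left B_scale_right scale_sum_right)
next
  fix I u n
  assume I: "finite I" "\<And>n. n \<in> I \<Longrightarrow> u n \<in> V n" "(\<Sum>n\<in>I. u n) = 0" "n \<in> I"
  have "\<pi> n (\<Sum>i\<in>J. u i) = (\<Sum>i\<in>J. \<pi> n (u i))" for J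
    by (induction J rule: infinite_finite_induct) (simp_all add: proj_zero proj_add)
  then have "0 = (\<Sum>i\<in>I. \<pi> n (u i))" using I(3) by (metis proj_zero)
  also have "\<dots> = (\<Sum>i\<in>I. if i = n then u n else 0)"
    by (intro sum.cong) (auto intro: proj_same[OF I(2)] proj_other[OF I(2)])
  finally show "u n = 0" using I(1,4) by simp
next
  fix x y z m n p
  assume x: "x \<in> V m" and y: "y \<in> V n"
  show "bilinear_extension \<pi> B x y \<in> V (m + n)"
    using x y B_closed by (simp add: bilinear_extension_homogeneous)
  show "bilinear_extension \<pi> B x y = - scale ((- 1) ^ (m * n)) (bilinear_extension \<pi> B y x)"
    unfolding bilinear_extension_homogeneous[OF x y] bilinear_extension_homogeneous[OF y x]
      scale_neg_one_power using x y by (rule B_skew)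
  assume z: "z \<in> V p"
  show "bilinear_extension \<pi> B x (bilinear_extension \<pi> B y z)
      = bilinear_extension \<pi> B (bilinear_extension \<pi> B x y) z
        + scale ((- 1) ^ (m * n)) (bilinear_extension \<pi> B y (bilinear_extension \<pi> B x z))"
    using B_jacobi[OF x y z] B_closed[OF y z] B_closed[OF x y] B_closed[OF x z] x y z
    by (simp add: bilinear_extension_homogeneous[of x m] bilinear_extension_homogeneous[of y n]
        bilinear_extension_homogeneous[of "B m n x y" "m + n"] scale_neg_one_power)
qed (rule subspace_component)

end

section \<open>The Nijenhuis-Richardson bracket\<close>

text \<open>
  The Nijenhuis-Richardson bracket indexed by degrees in place of arities, so that the exponent of the
  sign is the product of the indices.
\<close>

definition nr :: "('g \<Rightarrow> 'g) \<Rightarrow> nat \<Rightarrow> nat \<Rightarrow> ('g list \<Rightarrow> 'g) \<Rightarrow> ('g list \<Rightarrow> 'g) \<Rightarrow> 'g list \<Rightarrow> 'g::ab_group_add"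
  where "nr \<alpha> m n P Q = insertion \<alpha> m P Q - signed (m * n) (insertion \<alpha> n Q P)"

lemma vector_space_fun_scale:
  assumes "vector_space s"
  shows "vector_space (fun_scale s)"
proof -
  interpret vector_space s by fact
  show ?thesis
    by unfold_locales (simp_all add: fun_scale_def fun_eq_iff scale_right_distrib scale_left_distrib)
qed

lemma arity_part_add: "arity_part n (f + g) = arity_part n f + (arity_part n g :: 'g list \<Rightarrow> 'v::ab_group_add)"
  by (simp add: arity_part_def fun_eq_iff)

context vector_space
begin

lemma arity_part_fun_scale: "arity_part n (fun_scale scale c f) = fun_scale scale c (arity_part n f)"
  by (simp add: arity_part_def fun_scale_def fun_eq_iff)

end

context hom_modules
begin

sublocale fun_G: vector_space "fun_scale sg"
  by (rule vector_space_fun_scale[OF G.vector_space_axioms])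

sublocale fun_H: vector_space "fun_scale sh"
  by (rule vector_space_fun_scale[OF H.vector_space_axioms])

lemma subspace_cochains: "fun_H.subspace (cochains n)"
proof (rule fun_H.subspaceI)
  show "0 \<in> cochains n"
    by (simp add: cochains_iff alternating_multilinear_def)
next
  fix F F' assume F: "F \<in> cochains n" and F': "F' \<in> cochains n"
  have "alternating_multilinear sg sh (F + F')"
    unfolding alternating_multilinear_def
  proof (intro conjI allI)
    show "(F + F') (us @ x # y # vs) = - (F + F') (us @ y # x # vs)" for us x y vs
      using alternating_multilinearD(3)[OF cochainsD(2)[OF F], of us x y vs]
        alternating_multilinearD(3)[OF cochainsD(2)[OF F'], of us x y vs] by simp
  qed (simp_all add: alternating_multilinearD(1,2)[OF cochainsD(2)[OF F]]
      alternating_multilinearD(1,2)[OF cochainsD(2)[OF F']] H.scale_right_distrib)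
  moreover have "\<beta> (x + y) = \<beta> x + \<beta> y" for x y
    using linear_\<beta> by (simp add: Vector_Spaces.linear_iff)
  ultimately show "F + F' \<in> cochains n"
    using F F' by (simp add: cochains_iff)
next
  fix c F assume F: "F \<in> cochains n"
  have "Vector_Spaces.linear sh sh (sh c)"
    by (simp add: Vector_Spaces.linear_iff H.vector_space_axioms H.scale_right_distrib mult.commute)
  then have "alternating_multilinear sg sh (fun_scale sh c F)"
    unfolding fun_scale_def by (rule alternating_multilinear_linear[OF cochainsD(2)[OF F]])
  moreover have "\<beta> (sh c x) = sh c (\<beta> x)" for x
    using linear_\<beta> by (simp add: Vector_Spaces.linear_iff)
  ultimately show "fun_scale sh c F \<in> cochains n"
    using F by (auto simp: cochains_iff fun_scale_def fun_eq_iff)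
qed

lemma subspace_operators: "fun_G.subspace (operators n)"
  unfolding operators_eq by (rule hom_modules.subspace_cochains[OF source_modules])

lemma cochains_diff_signed: "F \<in> cochains n \<Longrightarrow> F' \<in> cochains n \<Longrightarrow> F - signed k F' \<in> cochains n"
  using fun_H.subspace_diff[OF subspace_cochains] fun_H.subspace_neg[OF subspace_cochains]
  by (simp add: signed_def)

lemma insertion_closed_operators:
  assumes "P \<in> operators m" and "Q \<in> operators n"
  shows "insertion \<alpha> m P Q \<in> operators (m + n)"
  using hom_modules.insertion_closed[OF source_modules assms(1) assms(2)[unfolded operators_eq]]
  by (simp add: operators_eq)

lemma nr_closed:
  assumes "P \<in> operators m" and "Q \<in> operators n"
  shows "nr \<alpha> m n P Q \<in> operators (m + n)"
proof -
  have "insertion \<alpha> n Q P \<in> operators (m + n)"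
    using insertion_closed_operators[OF assms(2,1)] by (simp add: add.commute)
  with insertion_closed_operators[OF assms] show ?thesis
    unfolding nr_def operators_eq by (rule hom_modules.cochains_diff_signed[OF source_modules])
qed

text \<open>
  For positive \<open>n\<close> this is \<open>sum_Sh_eq_unshuffle_sum\<close>. For \<open>n = 0\<close> the truncated subtraction leaves no
  room for the arguments of \<open>P\<close>, and both sides vanish together with \<open>F\<close>.
\<close>

lemma contraction_eq_insertion:
  assumes F: "F \<in> cochains n"
  shows "contraction \<alpha> sh (m + 1) n P F = insertion \<alpha> m P F"
proof
  fix xs :: "'g list"
  consider "length xs \<noteq> m + n" | "length xs = m + n" "n = 0" | n' where "length xs = m + n" "n = Suc n'"
    by (cases n) auto
  then show "contraction \<alpha> sh (m + 1) n P F xs = insertion \<alpha> m P F xs"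
  proof cases
    case 1
    then have "insertion \<alpha> m P F xs = 0"
      unfolding insertion_def by (intro unshuffle_sum_eq_0 cochainsD(1)[OF F]) auto
    with 1 show ?thesis by (simp add: contraction_def)
  next
    case 2
    then show ?thesis using cochainsD(4)[OF F]
      by (simp add: contraction_def insertion_def)
  next
    case 3
    then have "length xs = Suc m + n'" by simp
    from H.sum_Sh_eq_unshuffle_sum[OF this, of "\<lambda>ys zs. F (P ys # map (\<alpha> ^^ m) zs)"] 3
    show ?thesis by (simp add: contraction_def insertion_def o_def del: upt_Suc)
  qed
qed

lemma scale_neg_one_power_fun: "fun_scale sh ((-1) ^ k) F = signed k F"
  by (rule fun_H.scale_neg_one_power)

lemma nr_bracket_eq_nr:
  assumes P: "P \<in> operators m" and Q: "Q \<in> operators n"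
  shows "nr_bracket \<alpha> sg (m + 1) (n + 1) P Q = nr \<alpha> m n P Q"
proof -
  interpret S: hom_modules sg sg \<alpha> \<alpha> by (rule source_modules)
  show ?thesis
    using S.contraction_eq_insertion[OF P[unfolded operators_eq], of n Q]
      S.contraction_eq_insertion[OF Q[unfolded operators_eq], of m P]
    by (simp add: nr_bracket_def nr_def S.scale_neg_one_power_fun)
qed

lemma insertion_additive:
  "additive (insertion \<alpha> m P)" "F \<in> cochains n \<Longrightarrow> additive (\<lambda>P. insertion \<alpha> m P F)"
  using insertion_add_left
  by (simp_all add: additive_def fun_eq_iff insertion_def unshuffle_sum_add)

text \<open>
  Insertion represents the bracket: in the graded commutator of \<open>i\<^sub>P\<close> and \<open>i\<^sub>Q\<close> the double insertions cancel.
\<close>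

lemma insertion_nr:
  assumes P: "P \<in> operators m" and Q: "Q \<in> operators n" and F: "F \<in> cochains k"
  shows "insertion \<alpha> (m + n) (nr \<alpha> m n P Q) F
    = insertion \<alpha> m P (insertion \<alpha> n Q F) - signed (m * n) (insertion \<alpha> n Q (insertion \<alpha> m P F))"
  unfolding nr_def insertion_insertion[OF P Q F] insertion_insertion[OF Q P F]
    double_insertion_commute[OF F, of m n]
    additive.diff[OF insertion_additive(2)[OF F]]
  by (simp add: signed_def add.commute[of n m] additive.minus[OF insertion_additive(2)[OF F]])

lemma nr_skew: "nr \<alpha> m n P Q = - signed (m * n) (nr \<alpha> n m Q P)"
  by (simp add: nr_def signed_def mult.commute)

text \<open>
  With \<open>insertion_nr\<close> every term becomes a nested insertion of the three operators, and only the signs have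
  to be compared, which depend on the parities of the degrees.
\<close>

lemma nr_jacobi:
  assumes P: "P \<in> operators m" and Q: "Q \<in> operators n" and R: "R \<in> operators k"
  shows "nr \<alpha> m (n + k) P (nr \<alpha> n k Q R)
    = nr \<alpha> (m + n) k (nr \<alpha> m n P Q) R + signed (m * n) (nr \<alpha> n (m + k) Q (nr \<alpha> m k P R))"
proof -
  interpret S: hom_modules sg sg \<alpha> \<alpha> by (rule source_modules)
  note P' = P[unfolded operators_eq] and Q' = Q[unfolded operators_eq] and R' = R[unfolded operators_eq]
  have expand: "nr \<alpha> i j X Y = insertion \<alpha> i X Y - signed (i * j) (insertion \<alpha> j Y X)" for i j X Y
    by (rule nr_def)
  note add = additive.add[OF S.insertion_additive(1)]
    and diff = additive.diff[OF S.insertion_additive(1)]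
    and minus = additive.minus[OF S.insertion_additive(1)]
  show ?thesis
    unfolding expand[of m "n + k"] expand[of "m + n" k] expand[of n "m + k"]
      S.insertion_nr[OF Q R P'] S.insertion_nr[OF P Q R'] S.insertion_nr[OF P R Q']
    unfolding nr_def
    by (cases "even m"; cases "even n"; cases "even k") (simp_all add: signed_def add diff minus algebra_simps)
qed

end

section \<open>The semidirect product bracket\<close>

lemma semidirect_scale_Pair:
  assumes "vector_space sg" and "vector_space sh"
  shows "semidirect_scale sg sh c (P, E) = (fun_scale sg c P, fun_scale sh c E)"
proof -
  interpret vector_space_pair "fun_scale sg" "fun_scale sh"
    by (intro vector_space_pair.intro vector_space_fun_scale assms)
  interpret module_prod "fun_scale sg" "fun_scale sh" ..
  show ?thesis by (simp add: semidirect_scale_def scale_prod)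
qed

context hom_lie_module
begin

text \<open>
  The homogeneous bracket in terms of \<open>insertion\<close> and \<open>cup\<close>, to which the identities above apply.
\<close>

definition ltimes where
  "ltimes m n = (\<lambda>(P, E) (Q, F). (nr \<alpha> m n P Q,
    cup br \<beta> m n E F + insertion \<alpha> m P F - signed (m * n) (insertion \<alpha> n Q E)))"

lemma cup_bracket_eq_cup:
  assumes F: "F \<in> cochains n"
  shows "cup_bracket sh br \<beta> m n E F = cup br \<beta> m n E F"
proof
  fix xs :: "'g list"
  show "cup_bracket sh br \<beta> m n E F xs = cup br \<beta> m n E F xs"
  proof (cases "length xs = m + n")
    case True
    from H.sum_Sh_eq_unshuffle_sum[OF this] True show ?thesis
      by (simp add: cup_bracket_def cup_def)
  next
    case False
    then have "cup br \<beta> m n E F xs = 0"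
      unfolding cup_def by (intro unshuffle_sum_eq_0) (simp add: cochainsD(1)[OF F] br_simps)
    with False show ?thesis by (simp add: cup_bracket_def)
  qed
qed

lemma ltimes_homogeneous_eq_ltimes:
  assumes "P \<in> operators m" "E \<in> cochains m" "Q \<in> operators n" "F \<in> cochains n"
  shows "ltimes_homogeneous sg \<alpha> sh br \<beta> m n (P, E) (Q, F) = ltimes m n (P, E) (Q, F)"
  using assms
  by (simp add: ltimes_homogeneous_def ltimes_def nr_bracket_eq_nr[simplified] cup_bracket_eq_cup
      contraction_eq_insertion[simplified] scale_neg_one_power_fun)

lemma cup_additive: "additive (cup br \<beta> m n E)" "additive (\<lambda>E. cup br \<beta> m n E F)"
  by (simp_all add: additive_def cup_add_left cup_add_right)

text \<open>
  The Jacobi identity of a semidirect product. The second component is a combination of: the derivation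
  property of the three insertion operators, their commutation relations, and the Jacobi
  identity of the cup product bracket. Some terms occur with their two factors in opposite order
  (\<open>F_RE\<close>); the facts are stated with sums of degrees in a common order, so that equal terms agree
  syntactically. What remains is a comparison of signs for each parity of the degrees.
\<close>

lemma ltimes_jacobi:
  assumes P: "P \<in> operators m" and E: "E \<in> cochains m"
    and Q: "Q \<in> operators n" and F: "F \<in> cochains n"
    and R: "R \<in> operators k" and K: "K \<in> cochains k"
  shows "ltimes m (n + k) (P, E) (ltimes n k (Q, F) (R, K))
    = ltimes (m + n) k (ltimes m n (P, E) (Q, F)) (R, K)
      + signed (m * n) (ltimes n (m + k) (Q, F) (ltimes m k (P, E) (R, K)))"
proof -
  have PF_K: "insertion \<alpha> m P (cup br \<beta> n k F K)
      = cup br \<beta> (m + n) k (insertion \<alpha> m P F) K + signed (m * n) (cup br \<beta> n (m + k) F (insertion \<alpha> m P K))"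
    using P F K by (rule insertion_cup)
  have QE_K: "insertion \<alpha> n Q (cup br \<beta> m k E K)
      = cup br \<beta> (m + n) k (insertion \<alpha> n Q E) K + signed (m * n) (cup br \<beta> m (n + k) E (insertion \<alpha> n Q K))"
    using insertion_cup[OF Q E K] by (simp only: add.commute[of n m] mult.commute[of n m])
  have RE_F: "insertion \<alpha> k R (cup br \<beta> m n E F)
      = cup br \<beta> (m + k) n (insertion \<alpha> k R E) F + signed (m * k) (cup br \<beta> m (n + k) E (insertion \<alpha> k R F))"
    using insertion_cup[OF R E F] by (simp only: add.commute[of k] mult.commute[of k])
  have RE: "insertion \<alpha> k R E \<in> cochains (m + k)"
    using insertion_closed[OF R E] by (simp only: add.commute)
  have F_RE: "cup br \<beta> n (m + k) F (insertion \<alpha> k R E)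
      = - signed (n * (m + k)) (cup br \<beta> (m + k) n (insertion \<alpha> k R E) F)"
    using F RE by (rule cup_skew)
  note cups = additive.diff[OF cup_additive(1)] additive.diff[OF cup_additive(2)]
    additive.minus[OF cup_additive(1)] additive.minus[OF cup_additive(2)] cup_add_left cup_add_right
    and insertions = additive.diff[OF insertion_additive(1)] additive.add[OF insertion_additive(1)]
      additive.minus[OF insertion_additive(1)]
  have "cup br \<beta> m (n + k) E (cup br \<beta> n k F K + insertion \<alpha> n Q K - signed (n * k) (insertion \<alpha> k R F))
      + insertion \<alpha> m P (cup br \<beta> n k F K + insertion \<alpha> n Q K - signed (n * k) (insertion \<alpha> k R F))
      - signed (m * (n + k)) (insertion \<alpha> (n + k) (nr \<alpha> n k Q R) E)
    = cup br \<beta> (m + n) k (cup br \<beta> m n E F + insertion \<alpha> m P F - signed (m * n) (insertion \<alpha> n Q E)) K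
      + insertion \<alpha> (m + n) (nr \<alpha> m n P Q) K
      - signed ((m + n) * k) (insertion \<alpha> k R
          (cup br \<beta> m n E F + insertion \<alpha> m P F - signed (m * n) (insertion \<alpha> n Q E)))
      + signed (m * n) (cup br \<beta> n (m + k) F
          (cup br \<beta> m k E K + insertion \<alpha> m P K - signed (m * k) (insertion \<alpha> k R E))
        + insertion \<alpha> n Q (cup br \<beta> m k E K + insertion \<alpha> m P K - signed (m * k) (insertion \<alpha> k R E))
        - signed (n * (m + k)) (insertion \<alpha> (m + k) (nr \<alpha> m k P R) F))"
    unfolding insertion_nr[OF Q R E] insertion_nr[OF P Q K] insertion_nr[OF P R F]
    by (cases "even m"; cases "even n"; cases "even k")
      (simp_all add: signed_def cups insertions PF_K QE_K RE_F F_RE cup_jacobi[OF E F K])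
  then show ?thesis
    using nr_jacobi[OF P Q R] by (simp add: ltimes_def signed_def)
qed

lemma ltimes_components_closed:
  assumes P: "P \<in> operators m" and E: "E \<in> cochains m"
    and Q: "Q \<in> operators n" and F: "F \<in> cochains n"
  shows "ltimes m n (P, E) (Q, F) \<in> operators (m + n) \<times> cochains (m + n)"
proof -
  have "insertion \<alpha> n Q E \<in> cochains (m + n)"
    using insertion_closed[OF Q E] by (simp add: add.commute)
  then show ?thesis
    using nr_closed[OF P Q] cup_closed[OF E F] insertion_closed[OF P F]
      fun_H.subspace_add[OF subspace_cochains] cochains_diff_signed
    by (simp add: ltimes_def)
qed

end

section \<open>The graded Lie structures\<close>

lemma signed_fun_scale:
  assumes "vector_space s"
  shows "signed k (fun_scale s c F) = fun_scale s c (signed k F)"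
proof -
  interpret vector_space s by fact
  show ?thesis by (simp add: signed_def fun_scale_def fun_eq_iff)
qed

context hom_modules
begin

lemma arity_part_cochain:
  assumes "F \<in> cochains n"
  shows "arity_part m F = (if m = n then F else 0)"
  using cochainsD(1)[OF assms] by (auto simp: arity_part_def fun_eq_iff)

lemma arity_part_operator:
  assumes "P \<in> operators n"
  shows "arity_part (m + 1) P = (if m = n then P else 0)"
  using hom_modules.arity_part_cochain[OF source_modules assms[unfolded operators_eq], of "m + 1"] by simp

lemma nr_add:
  assumes "P \<in> operators m" "Q \<in> operators n"
  shows "P' \<in> operators m \<Longrightarrow> nr \<alpha> m n (P + P') Q = nr \<alpha> m n P Q + nr \<alpha> m n P' Q"
    and "Q' \<in> operators n \<Longrightarrow> nr \<alpha> m n P (Q + Q') = nr \<alpha> m n P Q + nr \<alpha> m n P Q'"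
proof -
  interpret S: hom_modules sg sg \<alpha> \<alpha> by (rule source_modules)
  note add = additive.add[OF S.insertion_additive(1)]
    additive.add[OF S.insertion_additive(2)[OF assms(1)[unfolded operators_eq]]]
    additive.add[OF S.insertion_additive(2)[OF assms(2)[unfolded operators_eq]]]
  show "nr \<alpha> m n (P + P') Q = nr \<alpha> m n P Q + nr \<alpha> m n P' Q"
    and "nr \<alpha> m n P (Q + Q') = nr \<alpha> m n P Q + nr \<alpha> m n P Q'"
    by (simp_all add: nr_def add signed_add_right)
qed

lemma nr_scale:
  assumes "P \<in> operators m" "Q \<in> operators n"
  shows "nr \<alpha> m n (fun_scale sg c P) Q = fun_scale sg c (nr \<alpha> m n P Q)"
    and "nr \<alpha> m n P (fun_scale sg c Q) = fun_scale sg c (nr \<alpha> m n P Q)"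
proof -
  interpret S: hom_modules sg sg \<alpha> \<alpha> by (rule source_modules)
  note scale = S.insertion_scale_right
    S.insertion_scale_left[OF assms(1)[unfolded operators_eq]]
    S.insertion_scale_left[OF assms(2)[unfolded operators_eq]]
  show "nr \<alpha> m n (fun_scale sg c P) Q = fun_scale sg c (nr \<alpha> m n P Q)"
    and "nr \<alpha> m n P (fun_scale sg c Q) = fun_scale sg c (nr \<alpha> m n P Q)"
    by (simp_all add: nr_def scale signed_fun_scale[OF G.vector_space_axioms] fun_G.scale_right_diff_distrib)
qed

lemma graded_bracket_nr:
  "graded_bracket (fun_scale sg) operators (\<lambda>m. arity_part (m + 1)) (\<lambda>m n. nr_bracket \<alpha> sg (m + 1) (n + 1))"
proof
  show "nr_bracket \<alpha> sg (m + 1) (n + 1) x y = - signed (m * n) (nr_bracket \<alpha> sg (n + 1) (m + 1) y x)"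
    if "x \<in> operators m" "y \<in> operators n" for x y m n
    unfolding nr_bracket_eq_nr[OF that] nr_bracket_eq_nr[OF that(2,1)] by (rule nr_skew)
next
  fix x y z m n p assume x: "x \<in> operators m" and y: "y \<in> operators n" and z: "z \<in> operators p"
  show "nr_bracket \<alpha> sg (m + 1) (n + p + 1) x (nr_bracket \<alpha> sg (n + 1) (p + 1) y z)
      = nr_bracket \<alpha> sg (m + n + 1) (p + 1) (nr_bracket \<alpha> sg (m + 1) (n + 1) x y) z
        + signed (m * n) (nr_bracket \<alpha> sg (n + 1) (m + p + 1) y (nr_bracket \<alpha> sg (m + 1) (p + 1) x z))"
    unfolding nr_bracket_eq_nr[OF x y] nr_bracket_eq_nr[OF y z] nr_bracket_eq_nr[OF x z]
      nr_bracket_eq_nr[OF x nr_closed[OF y z]] nr_bracket_eq_nr[OF nr_closed[OF x y] z]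
      nr_bracket_eq_nr[OF y nr_closed[OF x z]]
    using x y z by (rule nr_jacobi)
next
  fix x y m n assume x: "x \<in> operators m" and y: "y \<in> operators n"
  show "nr_bracket \<alpha> sg (m + 1) (n + 1) x y \<in> operators (m + n)"
    unfolding nr_bracket_eq_nr[OF x y] using x y by (rule nr_closed)
  show "nr_bracket \<alpha> sg (m + 1) (n + 1) (fun_scale sg c x) y
      = fun_scale sg c (nr_bracket \<alpha> sg (m + 1) (n + 1) x y)" for c
    using nr_scale(1)[OF x y] nr_bracket_eq_nr[OF fun_G.subspace_scale[OF subspace_operators x] y]
      nr_bracket_eq_nr[OF x y] by simp
  show "nr_bracket \<alpha> sg (m + 1) (n + 1) x (fun_scale sg c y)
      = fun_scale sg c (nr_bracket \<alpha> sg (m + 1) (n + 1) x y)" for c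
    using nr_scale(2)[OF x y] nr_bracket_eq_nr[OF x fun_G.subspace_scale[OF subspace_operators y]]
      nr_bracket_eq_nr[OF x y] by simp
  show "nr_bracket \<alpha> sg (m + 1) (n + 1) (x + x') y
      = nr_bracket \<alpha> sg (m + 1) (n + 1) x y + nr_bracket \<alpha> sg (m + 1) (n + 1) x' y"
    if "x' \<in> operators m" for x'
    unfolding nr_bracket_eq_nr[OF x y] nr_bracket_eq_nr[OF that y]
      nr_bracket_eq_nr[OF fun_G.subspace_add[OF subspace_operators x that] y]
    using x y that by (rule nr_add(1))
  show "nr_bracket \<alpha> sg (m + 1) (n + 1) x (y + y')
      = nr_bracket \<alpha> sg (m + 1) (n + 1) x y + nr_bracket \<alpha> sg (m + 1) (n + 1) x y'"
    if "y' \<in> operators n" for y'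
    unfolding nr_bracket_eq_nr[OF x y] nr_bracket_eq_nr[OF x that]
      nr_bracket_eq_nr[OF x fun_G.subspace_add[OF subspace_operators y that]]
    using x y that by (rule nr_add(2))
qed (simp_all add: subspace_operators arity_part_add G.arity_part_fun_scale arity_part_operator[simplified])

end

context hom_lie_module
begin

abbreviation "semidirect \<equiv> C_semidirect sg \<alpha> sh \<beta>"

lemma semidirect_iff: "(P, E) \<in> semidirect m \<longleftrightarrow> P \<in> operators m \<and> E \<in> cochains m"
  by (simp add: C_semidirect_def)

sublocale pairs: vector_space_pair "fun_scale sg" "fun_scale sh"
  by unfold_locales

lemma vector_space_semidirect: "vector_space (semidirect_scale sg sh)"
proof -
  interpret vector_space_prod "fun_scale sg" "fun_scale sh" ..
  show ?thesis unfolding semidirect_scale_def by (rule p.vector_space_axioms)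
qed

lemma subspace_Times_semidirect:
  assumes "fun_G.subspace A" and "fun_H.subspace B"
  shows "module.subspace (semidirect_scale sg sh) (A \<times> B)"
proof -
  interpret vector_space_prod "fun_scale sg" "fun_scale sh" ..
  show ?thesis unfolding semidirect_scale_def using assms by (rule subspace_Times)
qed

lemma ltimes_homogeneous_eq:
  assumes "x \<in> semidirect m" "y \<in> semidirect n"
  shows "ltimes_homogeneous sg \<alpha> sh br \<beta> m n x y = ltimes m n x y"
  using assms ltimes_homogeneous_eq_ltimes by (cases x; cases y) (simp add: semidirect_iff)

lemma ltimes_closed:
  assumes "x \<in> semidirect m" "y \<in> semidirect n"
  shows "ltimes m n x y \<in> semidirect (m + n)"
  using assms ltimes_components_closed by (cases x; cases y) (simp add: C_semidirect_def)

lemma ltimes_skew: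
  assumes "x \<in> semidirect m" "y \<in> semidirect n"
  shows "ltimes m n x y = - signed (m * n) (ltimes n m y x)"
proof -
  obtain P E Q F where xy: "x = (P, E)" "y = (Q, F)" by (cases x; cases y) blast
  have "E \<in> cochains m" "F \<in> cochains n" using assms by (simp_all add: xy semidirect_iff)
  from cup_skew[OF this] nr_skew[of m n P Q] show ?thesis
    by (simp add: xy ltimes_def signed_def mult.commute)
qed

lemma ltimes_add:
  assumes "x \<in> semidirect m" "y \<in> semidirect n"
  shows "x' \<in> semidirect m \<Longrightarrow> ltimes m n (x + x') y = ltimes m n x y + ltimes m n x' y"
    and "y' \<in> semidirect n \<Longrightarrow> ltimes m n x (y + y') = ltimes m n x y + ltimes m n x y'"
proof -
  obtain P E Q F P' E' Q' F' where eqs: "x = (P, E)" "y = (Q, F)" "x' = (P', E')" "y' = (Q', F')"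
    by (metis surj_pair)
  have P: "P \<in> operators m" and E: "E \<in> cochains m" and Q: "Q \<in> operators n" and F: "F \<in> cochains n"
    using assms by (simp_all add: eqs semidirect_iff)
  note add = additive.add[OF insertion_additive(1)] insertion_add_left[OF E] insertion_add_left[OF F]
    cup_add_left cup_add_right nr_add[OF P Q] signed_add_right
  show "x' \<in> semidirect m \<Longrightarrow> ltimes m n (x + x') y = ltimes m n x y + ltimes m n x' y"
    and "y' \<in> semidirect n \<Longrightarrow> ltimes m n x (y + y') = ltimes m n x y + ltimes m n x y'"
    by (simp_all add: ltimes_def semidirect_iff eqs add)
qed

lemma ltimes_scale:
  assumes "x \<in> semidirect m" "y \<in> semidirect n"
  shows "ltimes m n (semidirect_scale sg sh c x) y = semidirect_scale sg sh c (ltimes m n x y)"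
    and "ltimes m n x (semidirect_scale sg sh c y) = semidirect_scale sg sh c (ltimes m n x y)"
proof -
  obtain P E Q F where eqs: "x = (P, E)" "y = (Q, F)"
    by (metis surj_pair)
  have P: "P \<in> operators m" and E: "E \<in> cochains m" and Q: "Q \<in> operators n" and F: "F \<in> cochains n"
    using assms by (simp_all add: eqs semidirect_iff)
  note scale = insertion_scale_right insertion_scale_left[OF E] insertion_scale_left[OF F]
    cup_scale_left cup_scale_right nr_scale[OF P Q] signed_fun_scale[OF H.vector_space_axioms]
    semidirect_scale_Pair[OF G.vector_space_axioms H.vector_space_axioms]
  show "ltimes m n (semidirect_scale sg sh c x) y = semidirect_scale sg sh c (ltimes m n x y)"
    and "ltimes m n x (semidirect_scale sg sh c y) = semidirect_scale sg sh c (ltimes m n x y)"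
    by (simp_all add: ltimes_def eqs scale fun_H.scale_right_diff_distrib fun_H.scale_right_distrib)
qed

lemma graded_bracket_ltimes:
  "graded_bracket (semidirect_scale sg sh) semidirect
    (\<lambda>m (P, E). (arity_part (m + 1) P, arity_part m E)) (ltimes_homogeneous sg \<alpha> sh br \<beta>)"
proof -
  interpret vector_space "semidirect_scale sg sh" by (rule vector_space_semidirect)
  have sub: "subspace (semidirect n)" for n
    unfolding C_semidirect_def by (intro subspace_Times_semidirect subspace_operators subspace_cochains)
  note eq = ltimes_homogeneous_eq
  show ?thesis
  proof
    show "ltimes_homogeneous sg \<alpha> sh br \<beta> m n x y = - signed (m * n) (ltimes_homogeneous sg \<alpha> sh br \<beta> n m y x)"
      if "x \<in> semidirect m" "y \<in> semidirect n" for x y m n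
      unfolding eq[OF that] eq[OF that(2,1)] using that by (rule ltimes_skew)
  next
    fix x y z m n p assume x: "x \<in> semidirect m" and y: "y \<in> semidirect n" and z: "z \<in> semidirect p"
    show "ltimes_homogeneous sg \<alpha> sh br \<beta> m (n + p) x (ltimes_homogeneous sg \<alpha> sh br \<beta> n p y z)
      = ltimes_homogeneous sg \<alpha> sh br \<beta> (m + n) p (ltimes_homogeneous sg \<alpha> sh br \<beta> m n x y) z
        + signed (m * n) (ltimes_homogeneous sg \<alpha> sh br \<beta> n (m + p) y
            (ltimes_homogeneous sg \<alpha> sh br \<beta> m p x z))"
      unfolding eq[OF x y] eq[OF y z] eq[OF x z] eq[OF x ltimes_closed[OF y z]]
        eq[OF ltimes_closed[OF x y] z] eq[OF y ltimes_closed[OF x z]]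
    proof -
      obtain P E Q F R K where eqs: "x = (P, E)" "y = (Q, F)" "z = (R, K)"
        by (metis surj_pair)
      show "ltimes m (n + p) x (ltimes n p y z)
          = ltimes (m + n) p (ltimes m n x y) z + signed (m * n) (ltimes n (m + p) y (ltimes m p x z))"
        using x y z unfolding eqs semidirect_iff by (intro ltimes_jacobi) auto
    qed
  next
    fix x y m n assume x: "x \<in> semidirect m" and y: "y \<in> semidirect n"
    let ?B = "ltimes_homogeneous sg \<alpha> sh br \<beta> m n"
    show "?B x y \<in> semidirect (m + n)"
      unfolding eq[OF x y] using x y by (rule ltimes_closed)
    show "?B (semidirect_scale sg sh c x) y = semidirect_scale sg sh c (?B x y)" for c
      unfolding eq[OF x y] eq[OF subspace_scale[OF sub x] y] using x y by (rule ltimes_scale(1))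
    show "?B x (semidirect_scale sg sh c y) = semidirect_scale sg sh c (?B x y)" for c
      unfolding eq[OF x y] eq[OF x subspace_scale[OF sub y]] using x y by (rule ltimes_scale(2))
    show "?B (x + x') y = ?B x y + ?B x' y" if "x' \<in> semidirect m" for x'
      unfolding eq[OF x y] eq[OF that y] eq[OF subspace_add[OF sub x that] y]
      using x y that by (rule ltimes_add(1))
    show "?B x (y + y') = ?B x y + ?B x y'" if "y' \<in> semidirect n" for y'
      unfolding eq[OF x y] eq[OF x that] eq[OF x subspace_add[OF sub y that]]
      using x y that by (rule ltimes_add(2))
  qed (auto simp: sub arity_part_add G.arity_part_fun_scale H.arity_part_fun_scale
      semidirect_scale_Pair[OF G.vector_space_axioms H.vector_space_axioms] zero_prod_def
      semidirect_iff arity_part_operator[simplified] arity_part_cochain)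
qed

sublocale nr: graded_bracket "fun_scale sg" operators "\<lambda>m. arity_part (m + 1)"
    "\<lambda>m n. nr_bracket \<alpha> sg (m + 1) (n + 1)"
  rewrites "bilinear_extension (\<lambda>m. arity_part (m + 1)) (\<lambda>m n. nr_bracket \<alpha> sg (m + 1) (n + 1))
    = nr_total sg \<alpha>"
  by (rule graded_bracket_nr) (simp add: nr_total_def)

sublocale lt: graded_bracket "semidirect_scale sg sh" semidirect
    "\<lambda>m (P, E). (arity_part (m + 1) P, arity_part m E)" "ltimes_homogeneous sg \<alpha> sh br \<beta>"
  rewrites "bilinear_extension (\<lambda>m (P, E). (arity_part (m + 1) P, arity_part m E))
      (ltimes_homogeneous sg \<alpha> sh br \<beta>) = ltimes_total sg \<alpha> sh br \<beta>"
  by (rule graded_bracket_ltimes) (simp add: ltimes_total_def)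

lemma ltimes_total_eq_ltimes:
  assumes "x \<in> semidirect m" "y \<in> semidirect n"
  shows "ltimes_total sg \<alpha> sh br \<beta> x y = ltimes m n x y"
  using lt.bilinear_extension_homogeneous[OF assms] ltimes_homogeneous_eq[OF assms] by simp

lemma insertion_zero: "insertion \<alpha> m P 0 = 0" "F \<in> cochains n \<Longrightarrow> insertion \<alpha> m 0 F = 0"
  using additive.zero[OF insertion_additive(1)] additive.zero[OF insertion_additive(2)] by auto

lemma nr_zero: "P \<in> operators m \<Longrightarrow> nr \<alpha> m n P 0 = 0" "P \<in> operators m \<Longrightarrow> nr \<alpha> n m 0 P = 0"
  using nr_add(2)[of P m 0 n 0] nr_add(1)[of 0 n P m 0] fun_G.subspace_0[OF subspace_operators] by auto

lemma cup_zero: "cup br \<beta> m n 0 F = 0" "cup br \<beta> m n E 0 = 0"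
  using cup_add_left[of m n 0 0 F] cup_add_right[of m n E 0 0] by auto

lemma operators_subalgebra:
  "graded_lie_subalgebra (semidirect_scale sg sh) semidirect (ltimes_total sg \<alpha> sh br \<beta>)
    (\<lambda>m. operators m \<times> {0})"
proof
  fix m n and x y :: "('g list \<Rightarrow> 'g) \<times> ('g list \<Rightarrow> 'h)"
  show "module.subspace (semidirect_scale sg sh) (operators m \<times> {0})"
    by (intro subspace_Times_semidirect subspace_operators fun_H.subspace_single_0)
  show W: "operators k \<times> {0} \<subseteq> semidirect k" for k
    using fun_H.subspace_0[OF subspace_cochains] by (auto simp: semidirect_iff)
  assume xy: "x \<in> operators m \<times> {0}" "y \<in> operators n \<times> {0}"
  then have "x \<in> semidirect m" "y \<in> semidirect n" using W by blast+
  from ltimes_total_eq_ltimes[OF this] xy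
  show "ltimes_total sg \<alpha> sh br \<beta> x y \<in> operators (m + n) \<times> {0}"
    by (auto simp: ltimes_def nr_closed cup_zero insertion_zero)
qed

text \<open>
  The first component of a bracket depends additively on each of the two operators, so it vanishes as soon
  as one of them does.
\<close>

lemma cochains_ideal:
  "graded_lie_ideal (semidirect_scale sg sh) semidirect (ltimes_total sg \<alpha> sh br \<beta>)
    (\<lambda>m. {0} \<times> cochains m)"
proof
  fix m n and x y :: "('g list \<Rightarrow> 'g) \<times> ('g list \<Rightarrow> 'h)"
  show "module.subspace (semidirect_scale sg sh) ({0} \<times> cochains m)"
    by (intro subspace_Times_semidirect subspace_cochains fun_G.subspace_single_0)
  show W: "{0} \<times> cochains k \<subseteq> semidirect k" for k
    using fun_G.subspace_0[OF subspace_operators] by (auto simp: semidirect_iff)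
  { assume xy: "x \<in> semidirect m" "y \<in> {0} \<times> cochains n"
    then have y: "y \<in> semidirect n" using W by blast
    from ltimes_closed[OF xy(1) y] ltimes_total_eq_ltimes[OF xy(1) y] xy
    show "ltimes_total sg \<alpha> sh br \<beta> x y \<in> {0} \<times> cochains (m + n)"
      by (cases x; cases y) (auto simp: ltimes_def semidirect_iff nr_zero) }
  { assume xy: "x \<in> {0} \<times> cochains m" "y \<in> semidirect n"
    then have x: "x \<in> semidirect m" using W by blast
    from ltimes_closed[OF x xy(2)] ltimes_total_eq_ltimes[OF x xy(2)] xy
    show "ltimes_total sg \<alpha> sh br \<beta> x y \<in> {0} \<times> cochains (m + n)"
      by (cases x; cases y) (auto simp: ltimes_def semidirect_iff nr_zero) }
qed

text \<open>
  The extension of the semidirect product bracket and that of the Nijenhuis-Richardson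
  bracket sum over the same degrees, since \<open>(P, 0)\<close> and \<open>P\<close> have the same support.
\<close>

lemma ltimes_total_operators:
  assumes P: "P \<in> total_space (fun_scale sg) operators" and Q: "Q \<in> total_space (fun_scale sg) operators"
  shows "ltimes_total sg \<alpha> sh br \<beta> (P, 0) (Q, 0) = (nr_total sg \<alpha> P Q, 0)"
proof -
  have zero: "arity_part n (0 :: 'g list \<Rightarrow> 'h) = 0" for n
    by (simp add: arity_part_def fun_eq_iff)
  have sum: "(\<Sum>i\<in>I. (f i, 0 :: 'g list \<Rightarrow> 'h)) = (\<Sum>i\<in>I. f i, 0)" for f :: "nat \<Rightarrow> 'g list \<Rightarrow> 'g" and I
    by (simp add: prod_eq_iff fst_sum snd_sum)
  have lt: "ltimes_homogeneous sg \<alpha> sh br \<beta> m n (arity_part (m + 1) P, 0) (arity_part (n + 1) Q, 0)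
      = (nr_bracket \<alpha> sg (m + 1) (n + 1) (arity_part (m + 1) P) (arity_part (n + 1) Q), 0)" for m n
  proof -
    have x: "(arity_part (m + 1) P, 0) \<in> semidirect m" and y: "(arity_part (n + 1) Q, 0) \<in> semidirect n"
      using nr.proj_total(1)[OF P] nr.proj_total(1)[OF Q] fun_H.subspace_0[OF subspace_cochains]
      by (simp_all add: semidirect_iff)
    then show ?thesis
      unfolding ltimes_homogeneous_eq[OF x y]
      by (simp add: ltimes_def semidirect_iff cup_zero insertion_zero nr_bracket_eq_nr[simplified])
  qed
  show ?thesis
    using lt by (simp add: ltimes_total_def nr_total_def bilinear_extension_def zero zero_prod_def sum)
qed

end

theorem theorem4p3:
  fixes sg :: "'k::field_char_0 \<Rightarrow> 'g::ab_group_add \<Rightarrow> 'g"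
    and brg :: "'g \<Rightarrow> 'g \<Rightarrow> 'g" and \<alpha> :: "'g \<Rightarrow> 'g"
    and sh :: "'k \<Rightarrow> 'h::ab_group_add \<Rightarrow> 'h"
    and brh :: "'h \<Rightarrow> 'h \<Rightarrow> 'h" and \<beta> :: "'h \<Rightarrow> 'h"
  assumes "hom_lie_algebra sg brg \<alpha>"
    and "hom_lie_algebra sh brh \<beta>"
  shows "graded_lie_algebra (semidirect_scale sg sh) (C_semidirect sg \<alpha> sh \<beta>)
        (ltimes_total sg \<alpha> sh brh \<beta>) \<and>
    (\<forall>m n P E Q F. (P, E) \<in> C_semidirect sg \<alpha> sh \<beta> m \<longrightarrow> (Q, F) \<in> C_semidirect sg \<alpha> sh \<beta> n \<longrightarrow>
      ltimes_total sg \<alpha> sh brh \<beta> (P, E) (Q, F) =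
        (nr_bracket \<alpha> sg (m + 1) (n + 1) P Q,
         cup_bracket sh brh \<beta> m n E F + contraction \<alpha> sh (m + 1) n P F
           - fun_scale sh ((-1) ^ (m * n)) (contraction \<alpha> sh (n + 1) m Q E))) \<and>
    graded_lie_algebra (fun_scale sg) (C_gg sg \<alpha>) (nr_total sg \<alpha>) \<and>
    graded_lie_subalgebra (semidirect_scale sg sh) (C_semidirect sg \<alpha> sh \<beta>)
      (ltimes_total sg \<alpha> sh brh \<beta>) (\<lambda>m. C_gg sg \<alpha> m \<times> {0}) \<and>
    (\<forall>P \<in> total_space (fun_scale sg) (C_gg sg \<alpha>). \<forall>Q \<in> total_space (fun_scale sg) (C_gg sg \<alpha>).
      ltimes_total sg \<alpha> sh brh \<beta> (P, 0) (Q, 0) = (nr_total sg \<alpha> P Q, 0)) \<and>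
    graded_lie_ideal (semidirect_scale sg sh) (C_semidirect sg \<alpha> sh \<beta>)
      (ltimes_total sg \<alpha> sh brh \<beta>) (\<lambda>m. {0} \<times> C_gh sg \<alpha> sh \<beta> m)"
proof -
  interpret g: hom_lie_algebra sg brg \<alpha> by fact
  interpret h: hom_lie_algebra sh brh \<beta> by fact
  interpret hom_lie_module sg sh \<alpha> \<beta> brh
    by (simp add: hom_lie_module_def hom_modules_def hom_modules_axioms_def g.linear_twist
        h.linear_twist g.vector_space_axioms h.vector_space_axioms h.hom_lie_algebra_axioms)
  show ?thesis
    using lt.graded_lie_algebra_axioms nr.graded_lie_algebra_axioms operators_subalgebra
      ltimes_total_operators cochains_ideal lt.bilinear_extension_homogeneous
    by (auto simp: ltimes_homogeneous_def)
qed

end
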